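(* Let $\mu$ be a $\sigma$-finite positive measure on a set $X$, and let $A$ be a (bounded) positive operator on the complex Hilbert space $L^2(X,\mu)$. For each $n \in \mathbb{N} \cup \{0\}$ put $$\sigma_n = r\bigl(M(A^{2^n})\bigr)^{2^{-n}},$$ where $r(\cdot)$ denotes the spectral radius and $M(B) = (B + B^* )/2$ for an operator $B$. Then, for each $n \in \mathbb{N} \cup \{0\}$, $$\sigma_0 \ge \sigma_1 \ge \ldots \ge \sigma_n \ge r(A).$$ Furthermore, the sequence $\{\sigma_n\}_{n \in \mathbb{N}}$ converges to $r(A)$.
   Context: All operators are bounded linear operators on the complex Hilbert space $L^2(X,\mu)$, where $\mu$ is a $\sigma$-finite positive measure on $X$. An operator on $L^2(X,\mu)$ is called positive if it maps nonnegative functions to nonnegative functions (this is positivity in the order sense, not positive semidefiniteness). The spectral radius of an operator is denoted by $r(\cdot)$. For a positive operator $A$, the arithmetic symmetrization of $A$ is the positive selfadjoint operator $M(A) = (A + A^* )/2$, where $A^*$ is the Hilbert space adjoint. *)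

theory Defs
  imports "HOL-Analysis.Analysis" "HOL-Library.Nonpos_Ints"
begin

text \<open>
  The complex space \<open>L\<^sup>2(\<mu>)\<close> is handled through representatives: an element is a
  square-integrable measurable function, and equality of elements is equality almost everywhere.
  Accordingly, an operator is a map on representatives that respects almost-everywhere equality,
  and identities between operators are required almost everywhere.  Values of an operator outside
  the space are irrelevant.
\<close>

definition L2_space :: "'a measure \<Rightarrow> ('a \<Rightarrow> complex) set" where
  "L2_space M = {f \<in> borel_measurable M. integrable M (\<lambda>x. (cmod (f x))\<^sup>2)}"

definition L2_inner :: "'a measure \<Rightarrow> ('a \<Rightarrow> complex) \<Rightarrow> ('a \<Rightarrow> complex) \<Rightarrow> complex" where
  "L2_inner M f g = (LINT x|M. f x * cnj (g x))"

definition L2_norm :: "'a measure \<Rightarrow> ('a \<Rightarrow> complex) \<Rightarrow> real" where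
  "L2_norm M f = sqrt (LINT x|M. (cmod (f x))\<^sup>2)"

type_synonym 'a fun_op = "('a \<Rightarrow> complex) \<Rightarrow> ('a \<Rightarrow> complex)"

definition L2_bounded_operator :: "'a measure \<Rightarrow> 'a fun_op \<Rightarrow> bool" where
  "L2_bounded_operator M T \<longleftrightarrow>
     (\<forall>f\<in>L2_space M. T f \<in> L2_space M) \<and>
     (\<forall>f\<in>L2_space M. \<forall>g\<in>L2_space M.
        (AE x in M. f x = g x) \<longrightarrow> (AE x in M. T f x = T g x)) \<and>
     (\<forall>f\<in>L2_space M. \<forall>g\<in>L2_space M. AE x in M. T (\<lambda>y. f y + g y) x = T f x + T g x) \<and>
     (\<forall>c. \<forall>f\<in>L2_space M. AE x in M. T (\<lambda>y. c * f y) x = c * T f x) \<and>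
     (\<exists>C. \<forall>f\<in>L2_space M. L2_norm M (T f) \<le> C * L2_norm M f)"

text \<open>Positivity in the sense of the order, not positive semidefiniteness.\<close>

definition L2_positive :: "'a measure \<Rightarrow> 'a fun_op \<Rightarrow> bool" where
  "L2_positive M T \<longleftrightarrow>
     (\<forall>f\<in>L2_space M. (AE x in M. f x \<in> \<real>\<^sub>\<ge>\<^sub>0) \<longrightarrow> (AE x in M. T f x \<in> \<real>\<^sub>\<ge>\<^sub>0))"

text \<open>
  For a bounded operator the function chosen here exists and is unique up to almost-everywhere
  equality, by the Riesz representation theorem.
\<close>

definition L2_adjoint :: "'a measure \<Rightarrow> 'a fun_op \<Rightarrow> 'a fun_op" where
  "L2_adjoint M T g =
     (SOME h. h \<in> L2_space M \<and> (\<forall>f\<in>L2_space M. L2_inner M (T f) g = L2_inner M f h))"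

definition arith_symm :: "'a measure \<Rightarrow> 'a fun_op \<Rightarrow> 'a fun_op" where
  "arith_symm M T = (\<lambda>f x. (T f x + L2_adjoint M T f x) / 2)"

definition L2_spectrum :: "'a measure \<Rightarrow> 'a fun_op \<Rightarrow> complex set" where
  "L2_spectrum M T = {z. \<not> (\<exists>S. L2_bounded_operator M S \<and>
     (\<forall>f\<in>L2_space M. AE x in M. S (\<lambda>y. z * f y - T f y) x = f x) \<and>
     (\<forall>f\<in>L2_space M. AE x in M. z * S f x - T (S f) x = f x))}"

text \<open>
  Inserting \<open>0\<close> only matters when \<open>L\<^sup>2(\<mu>)\<close> is the zero space: then the spectrum is
  empty and the spectral radius is \<open>0\<close>.
\<close>

definition L2_spectral_radius :: "'a measure \<Rightarrow> 'a fun_op \<Rightarrow> real" where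
  "L2_spectral_radius M T = Sup (insert 0 (cmod ` L2_spectrum M T))"

definition symm_radius_seq :: "'a measure \<Rightarrow> 'a fun_op \<Rightarrow> nat \<Rightarrow> real" where
  "symm_radius_seq M A n = L2_spectral_radius M (arith_symm M (A ^^ (2 ^ n))) powr (1 / 2 ^ n)"

end

theory Submission
  imports Defs
begin

text \<open>
  Write \<open>\<parallel>T\<parallel>\<close> for the operator norm, \<open>M(T)\<close> for the arithmetic symmetrization and \<open>|f|\<close> for the
  pointwise modulus. Everything is reduced to norms of \<open>M(A\<^sup>k)\<close> with \<open>k = 2 ^ n\<close>, by four facts.

  \<^item> The power inequality \<open>\<parallel>M(B\<^sup>2)\<parallel> \<le> \<parallel>M(B)\<parallel>\<^sup>2\<close> for positive \<open>B\<close>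
    (\<open>arith_symm_opnorm_square\<close>). For every \<open>f\<close>, polarization gives
    \<open>Re \<langle>B\<^sup>2 f, f\<rangle> = Re \<langle>B f, B\<^sup>* f\<rangle> \<le> \<parallel>(B f + B\<^sup>* f) / 2\<parallel>\<^sup>2 = \<parallel>M(B) f\<parallel>\<^sup>2\<close>, and for a positive symmetric
    operator an upper bound on the quadratic form is a bound on the norm: positivity gives
    \<open>|T f| \<le> T |f|\<close>, hence \<open>|\<langle>T f, f\<rangle>| \<le> \<langle>T |f|, |f|\<rangle>\<close>.

  \<^item> The comparison \<open>\<parallel>M(B)\<parallel> \<le> \<parallel>B\<parallel> \<le> 2 \<parallel>M(B)\<parallel>\<close> for positive \<open>B\<close> (\<open>arith_symm_opnorm_le\<close>,
    \<open>opnorm_le_arith_symm\<close>); the second inequality holds because \<open>0 \<le> B f \<le> 2 M(B) f\<close> for \<open>f \<ge> 0\<close>.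

  \<^item> The spectral radius formula \<open>r(T) = lim \<parallel>T\<^sup>k\<parallel> powr (1 / k)\<close>, \<open>k = 2 ^ n\<close>, for positive \<open>T\<close>
    (\<open>L2_spectral_radius_positive\<close>).

  \<^item> Its consequence \<open>r(S) = \<parallel>S\<parallel>\<close> for positive symmetric \<open>S\<close>
    (\<open>L2_spectral_radius_symmetric\<close>), since then \<open>\<parallel>S\<^sup>2\<parallel> = \<parallel>S\<parallel>\<^sup>2\<close>.

  By the last fact \<open>\<sigma>\<^sub>n = \<parallel>M(A\<^sup>k)\<parallel> powr (1 / k)\<close>. The power inequality with \<open>B = A\<^sup>k\<close> makes this
  sequence decreasing, so it has a limit \<open>L \<le> \<sigma>\<^sub>n\<close>. By the comparison, \<open>\<parallel>A\<^sup>k\<parallel> powr (1 / k)\<close> differs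
  from \<open>\<sigma>\<^sub>n\<close> by a factor between \<open>1\<close> and \<open>2 powr (1 / k)\<close> and has the same limit, and the spectral
  radius formula says that this limit is \<open>r(A)\<close>.

  In the spectral radius formula the inequality \<open>r(T) \<le> lim\<close> is the Neumann series, summed pointwise
  almost everywhere. For the converse the order replaces complex analysis. Suppose that the limit
  \<open>L > 0\<close> is not in the spectrum. Then \<open>L - T\<close> is bounded below, so for \<open>t\<close> slightly above \<open>L\<close> the
  partial sums \<open>P\<close> of the Neumann series at \<open>t\<close> are bounded independently of \<open>t\<close> and of
  their length. For \<open>f \<ge> 0\<close> the square of the partial sum with \<open>m + 1\<close> terms dominates the terms
  containing \<open>T ^ m\<close>, that is \<open>P (P f) \<ge> (m + 1) T ^ m f / t ^ (m + 2)\<close>. As \<open>t\<close> tends to \<open>L\<close> this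
  yields \<open>(m + 1) \<parallel>T ^ m\<parallel> \<le> const * L ^ (m + 2)\<close>, against \<open>\<parallel>T ^ m\<parallel> \<ge> L ^ m\<close> for \<open>m = 2 ^ n\<close>.

  Throughout, functions are representatives: the norm is only a seminorm on them, and pointwise
  statements about operators hold almost everywhere.
\<close>

section \<open>Square-integrable functions\<close>

lemma L2_space_measurable [measurable_dest]: "f \<in> L2_space M \<Longrightarrow> f \<in> borel_measurable M"
  by (simp add: L2_space_def)

lemma L2_space_integrable: "f \<in> L2_space M \<Longrightarrow> integrable M (\<lambda>x. (cmod (f x))\<^sup>2)"
  by (simp add: L2_space_def)

lemma L2_space_dominated:
  assumes "f \<in> borel_measurable M" "g \<in> L2_space M" "AE x in M. cmod (f x) \<le> cmod (g x)"
  shows "f \<in> L2_space M"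
proof -
  have "integrable M (\<lambda>x. (cmod (f x))\<^sup>2)"
    by (rule Bochner_Integration.integrable_bound[OF L2_space_integrable[OF assms(2)]])
      (use assms in \<open>auto intro: power_mono\<close>)
  then show ?thesis using assms(1) by (simp add: L2_space_def)
qed

lemma L2_space_add:
  assumes f: "f \<in> L2_space M" and g: "g \<in> L2_space M"
  shows "(\<lambda>x. f x + g x) \<in> L2_space M"
proof -
  have [measurable]: "f \<in> borel_measurable M" "g \<in> borel_measurable M"
    using f g by (auto simp: L2_space_def)
  have pw: "(cmod (a + b))\<^sup>2 \<le> 2 * (cmod a)\<^sup>2 + 2 * (cmod b)\<^sup>2" for a b :: complex
  proof -
    have "(cmod (a + b))\<^sup>2 \<le> (cmod a + cmod b)\<^sup>2"
      by (intro power_mono norm_triangle_ineq) auto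
    also have "\<dots> \<le> 2 * (cmod a)\<^sup>2 + 2 * (cmod b)\<^sup>2"
      using sum_squares_bound[of "cmod a" "cmod b"] by (simp add: power2_sum)
    finally show ?thesis .
  qed
  have "integrable M (\<lambda>x. 2 * (cmod (f x))\<^sup>2 + 2 * (cmod (g x))\<^sup>2)"
    using f g by (simp add: L2_space_def)
  then have "integrable M (\<lambda>x. (cmod (f x + g x))\<^sup>2)"
    by (rule Bochner_Integration.integrable_bound) (auto simp: pw)
  then show ?thesis by (simp add: L2_space_def)
qed

lemma L2_space_scale:
  assumes f: "f \<in> L2_space M"
  shows "(\<lambda>x. c * f x) \<in> L2_space M"
  using f by (auto simp: L2_space_def norm_mult power_mult_distrib)

lemma L2_space_zero: "(\<lambda>x. 0) \<in> L2_space M"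
  by (simp add: L2_space_def)

lemma L2_space_diff:
  assumes f: "f \<in> L2_space M" and g: "g \<in> L2_space M"
  shows "(\<lambda>x. f x - g x) \<in> L2_space M"
  using L2_space_add[OF f L2_space_scale[OF g, of "-1"]] by simp

lemma L2_space_divide: "f \<in> L2_space M \<Longrightarrow> (\<lambda>x. f x / c) \<in> L2_space M"
  using L2_space_scale[of f M "inverse c"] by (simp add: field_simps)

lemma L2_space_sum:
  "(\<And>i. i \<in> I \<Longrightarrow> f i \<in> L2_space M) \<Longrightarrow> (\<lambda>x. \<Sum>i\<in>I. f i x) \<in> L2_space M"
  by (induction I rule: infinite_finite_induct) (auto intro: L2_space_zero L2_space_add)

lemma L2_space_of_real:
  assumes "f \<in> L2_space M" "h \<in> borel_measurable M" "\<And>x. \<bar>h x\<bar> \<le> cmod (f x)"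
  shows "(\<lambda>x. complex_of_real (h x)) \<in> L2_space M"
  by (rule L2_space_dominated[OF _ assms(1)]) (use assms(2,3) in auto)

lemma L2_space_cmod: "f \<in> L2_space M \<Longrightarrow> (\<lambda>x. complex_of_real (cmod (f x))) \<in> L2_space M"
  by (rule L2_space_of_real) (auto simp: L2_space_def)

lemmas L2_space_intros =
  L2_space_add L2_space_scale L2_space_zero L2_space_diff L2_space_divide L2_space_sum L2_space_cmod

lemma borel_measurable_cnj [measurable]:
  "f \<in> borel_measurable M \<Longrightarrow> (\<lambda>x. cnj (f x)) \<in> borel_measurable M"
  by (rule borel_measurable_continuous_on[of cnj]) (auto intro: continuous_intros)

lemma L2_inner_integrable:
  assumes f: "f \<in> L2_space M" and g: "g \<in> L2_space M"
  shows "integrable M (\<lambda>x. f x * cnj (g x))"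
proof -
  have [measurable]: "f \<in> borel_measurable M" "g \<in> borel_measurable M"
    using f g by (auto simp: L2_space_def)
  have "integrable M (\<lambda>x. (cmod (f x))\<^sup>2 + (cmod (g x))\<^sup>2)"
    using f g by (simp add: L2_space_def)
  then show ?thesis
  proof (rule Bochner_Integration.integrable_bound)
    show "AE x in M. norm (f x * cnj (g x)) \<le> norm ((cmod (f x))\<^sup>2 + (cmod (g x))\<^sup>2)"
    proof (rule AE_I2)
      fix x
      have "cmod (f x) * cmod (g x) \<le> (cmod (f x))\<^sup>2 + (cmod (g x))\<^sup>2"
        using sum_squares_bound[of "cmod (f x)" "cmod (g x)"]
          mult_nonneg_nonneg[OF norm_ge_zero norm_ge_zero, of "f x" "g x"] by linarith
      then show "norm (f x * cnj (g x)) \<le> norm ((cmod (f x))\<^sup>2 + (cmod (g x))\<^sup>2)"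
        by (simp add: norm_mult)
    qed
  qed measurable
qed

lemma L2_inner_add_left:
  assumes "f \<in> L2_space M" "g \<in> L2_space M" "h \<in> L2_space M"
  shows "L2_inner M (\<lambda>x. f x + g x) h = L2_inner M f h + L2_inner M g h"
  using Bochner_Integration.integral_add[OF L2_inner_integrable[OF assms(1,3)] L2_inner_integrable[OF assms(2,3)]]
  by (simp add: L2_inner_def algebra_simps)

lemma L2_inner_scale_left: "L2_inner M (\<lambda>x. c * f x) h = c * L2_inner M f h"
  by (simp add: L2_inner_def mult.assoc)

lemma L2_inner_commute: "L2_inner M g f = cnj (L2_inner M f g)"
  by (simp add: L2_inner_def mult.commute flip: Bochner_Integration.integral_cnj)

lemma L2_inner_add_right:
  assumes "f \<in> L2_space M" "g \<in> L2_space M" "h \<in> L2_space M"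
  shows "L2_inner M h (\<lambda>x. f x + g x) = L2_inner M h f + L2_inner M h g"
  using L2_inner_add_left[OF assms] L2_inner_commute[of M h] by (metis complex_cnj_add)

lemma L2_inner_scale_right: "L2_inner M h (\<lambda>x. c * f x) = cnj c * L2_inner M h f"
  using L2_inner_scale_left[of M c f h] L2_inner_commute[of M h] by (metis complex_cnj_mult)

lemma L2_inner_diff_right:
  assumes "f \<in> L2_space M" "g \<in> L2_space M" "h \<in> L2_space M"
  shows "L2_inner M h (\<lambda>x. f x - g x) = L2_inner M h f - L2_inner M h g"
  using L2_inner_add_right[OF assms(1) L2_space_scale[OF assms(2), of "-1"] assms(3)]
    L2_inner_scale_right[of M h "-1" g] by simp

lemma L2_inner_cong:
  assumes "f \<in> borel_measurable M" "f' \<in> borel_measurable M" "AE x in M. f x = f' x"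
    and "g \<in> borel_measurable M" "g' \<in> borel_measurable M" "AE x in M. g x = g' x"
  shows "L2_inner M f g = L2_inner M f' g'"
proof -
  note [measurable] = assms(1,2,4,5)
  show ?thesis
    unfolding L2_inner_def by (rule integral_cong_AE) (use assms(3,6) in \<open>auto elim: eventually_elim2\<close>)
qed

lemma L2_inner_congL:
  assumes "f \<in> L2_space M" "f' \<in> L2_space M" "AE x in M. f x = f' x" "g \<in> L2_space M"
  shows "L2_inner M f g = L2_inner M f' g"
  by (rule L2_inner_cong) (use assms in \<open>auto simp: L2_space_def\<close>)

lemma L2_inner_congR:
  assumes "f \<in> L2_space M" "f' \<in> L2_space M" "AE x in M. f x = f' x" "g \<in> L2_space M"
  shows "L2_inner M g f = L2_inner M g f'"
  by (rule L2_inner_cong) (use assms in \<open>auto simp: L2_space_def\<close>)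

lemma L2_norm_nonneg [simp]: "0 \<le> L2_norm M f"
  by (simp add: L2_norm_def)

lemma L2_norm_square: "(L2_norm M f)\<^sup>2 = (LINT x|M. (cmod (f x))\<^sup>2)"
  by (simp add: L2_norm_def)

lemma L2_inner_self: "L2_inner M f f = of_real ((L2_norm M f)\<^sup>2)"
  by (simp add: L2_inner_def L2_norm_square complex_norm_square [symmetric] del: of_real_power)

lemma L2_norm_mono:
  assumes "f \<in> L2_space M" "g \<in> L2_space M" "AE x in M. cmod (f x) \<le> cmod (g x)"
  shows "L2_norm M f \<le> L2_norm M g"
  unfolding L2_norm_def
  by (intro real_sqrt_le_mono integral_mono_AE)
    (use assms in \<open>auto simp: L2_space_def intro: power_mono\<close>)

lemma L2_norm_cong:
  assumes "f \<in> L2_space M" "g \<in> L2_space M" "AE x in M. f x = g x"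
  shows "L2_norm M f = L2_norm M g"
  using assms by (intro antisym L2_norm_mono) auto

lemma L2_norm_eq_0_iff:
  assumes "f \<in> L2_space M"
  shows "L2_norm M f = 0 \<longleftrightarrow> (AE x in M. f x = 0)"
  using integral_nonneg_eq_0_iff_AE[OF L2_space_integrable[OF assms]] by (simp add: L2_norm_def)

lemma L2_norm_scale: "L2_norm M (\<lambda>x. c * f x) = cmod c * L2_norm M f"
  by (simp add: L2_norm_def norm_mult power_mult_distrib real_sqrt_mult)

lemma L2_norm_divide: "L2_norm M (\<lambda>x. f x / c) = L2_norm M f / cmod c"
  using L2_norm_scale[of M "inverse c" f] by (simp add: divide_inverse mult.commute norm_inverse)

lemma L2_norm_cmod [simp]: "L2_norm M (\<lambda>x. complex_of_real (cmod (f x))) = L2_norm M f"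
  by (simp add: L2_norm_def)

text \<open>
  The whole Euclidean geometry of the space (Cauchy--Schwarz, parallelogram and polarization
  identities, perturbation of a quadratic functional) is read off from this expansion.
\<close>

lemma L2_norm_add_square:
  assumes f: "f \<in> L2_space M" and g: "g \<in> L2_space M"
  shows "(L2_norm M (\<lambda>x. f x + c * g x))\<^sup>2
       = (L2_norm M f)\<^sup>2 + 2 * Re (cnj c * L2_inner M f g) + (cmod c)\<^sup>2 * (L2_norm M g)\<^sup>2"
proof -
  have cg: "(\<lambda>x. c * g x) \<in> L2_space M" by (rule L2_space_scale[OF g])
  have "L2_inner M (\<lambda>x. f x + c * g x) (\<lambda>x. f x + c * g x)
      = L2_inner M f f + cnj c * L2_inner M f g + c * cnj (L2_inner M f g)
        + c * cnj c * L2_inner M g g"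
    using f g cg
    by (simp add: L2_inner_add_left L2_inner_add_right L2_inner_scale_left L2_inner_scale_right
        L2_space_add L2_inner_commute[of M g f] algebra_simps)
  then have "Re (L2_inner M (\<lambda>x. f x + c * g x) (\<lambda>x. f x + c * g x))
      = (L2_norm M f)\<^sup>2 + 2 * Re (cnj c * L2_inner M f g) + (cmod c)\<^sup>2 * (L2_norm M g)\<^sup>2"
    by (simp add: L2_inner_self del: of_real_power flip: of_real_mult complex_norm_square)
  then show ?thesis by (simp add: L2_inner_self del: of_real_power)
qed

lemma L2_norm_add_square':
  assumes f: "f \<in> L2_space M" and g: "g \<in> L2_space M"
  shows "(L2_norm M (\<lambda>x. f x + g x))\<^sup>2
       = (L2_norm M f)\<^sup>2 + 2 * Re (L2_inner M f g) + (L2_norm M g)\<^sup>2"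
    and "(L2_norm M (\<lambda>x. f x - g x))\<^sup>2
       = (L2_norm M f)\<^sup>2 - 2 * Re (L2_inner M f g) + (L2_norm M g)\<^sup>2"
  using L2_norm_add_square[OF assms, of 1] L2_norm_add_square[OF assms, of "-1"] by simp_all

text \<open>
  The expansion above is nonnegative; it is used at the coefficient that minimizes it over \<open>c\<close>.
\<close>

lemma L2_Cauchy_Schwarz:
  assumes f: "f \<in> L2_space M" and g: "g \<in> L2_space M"
  shows "cmod (L2_inner M f g) \<le> L2_norm M f * L2_norm M g"
proof (cases "L2_norm M g = 0")
  case True
  then have "AE x in M. g x = 0" using L2_norm_eq_0_iff[OF g] by simp
  then have "L2_inner M f g = L2_inner M f (\<lambda>x. 0)"
    by (intro L2_inner_congR) (use f g in \<open>auto intro: L2_space_zero\<close>)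
  then show ?thesis by (simp add: L2_inner_def)
next
  case False
  let ?z = "L2_inner M f g" and ?n = "(L2_norm M g)\<^sup>2"
  have n: "?n > 0" using False by simp
  let ?c = "- ?z / of_real ?n"
  have "0 \<le> (L2_norm M (\<lambda>x. f x + ?c * g x))\<^sup>2" by simp
  also have "\<dots> = (L2_norm M f)\<^sup>2 + 2 * Re (cnj ?c * ?z) + (cmod ?c)\<^sup>2 * ?n"
    by (rule L2_norm_add_square[OF f g])
  also have "cnj ?c * ?z = of_real (- (cmod ?z)\<^sup>2 / ?n)"
    using complex_norm_square[of ?z] by (simp add: mult.commute)
  also have "(cmod ?c)\<^sup>2 * ?n = (cmod ?z)\<^sup>2 / ?n"
    using False n by (simp add: norm_divide norm_power power_divide power2_eq_square norm_mult)
  finally have "(cmod ?z)\<^sup>2 / ?n \<le> (L2_norm M f)\<^sup>2" by simp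
  then have "(cmod ?z)\<^sup>2 \<le> (L2_norm M f * L2_norm M g)\<^sup>2"
    using n by (simp add: power_mult_distrib pos_divide_le_eq)
  then show ?thesis by (rule power2_le_imp_le) simp
qed

lemma L2_norm_triangle:
  assumes f: "f \<in> L2_space M" and g: "g \<in> L2_space M"
  shows "L2_norm M (\<lambda>x. f x + g x) \<le> L2_norm M f + L2_norm M g"
proof (rule power2_le_imp_le)
  have "Re (L2_inner M f g) \<le> L2_norm M f * L2_norm M g"
    using L2_Cauchy_Schwarz[OF assms] complex_Re_le_cmod[of "L2_inner M f g"] by linarith
  then show "(L2_norm M (\<lambda>x. f x + g x))\<^sup>2 \<le> (L2_norm M f + L2_norm M g)\<^sup>2"
    by (simp add: L2_norm_add_square'[OF assms] power2_sum)
qed simp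

lemma L2_norm_triangle_diff:
  assumes f: "f \<in> L2_space M" and g: "g \<in> L2_space M"
  shows "L2_norm M (\<lambda>x. f x - g x) \<le> L2_norm M f + L2_norm M g"
  using L2_norm_triangle[OF f L2_space_scale[OF g, of "-1"]] L2_norm_scale[of M "-1" g] by simp

lemma L2_norm_sum:
  "(\<And>i. i \<in> I \<Longrightarrow> f i \<in> L2_space M) \<Longrightarrow> L2_norm M (\<lambda>x. \<Sum>i\<in>I. f i x) \<le> (\<Sum>i\<in>I. L2_norm M (f i))"
proof (induction I rule: infinite_finite_induct)
  case (insert i I)
  then have "L2_norm M (\<lambda>x. f i x + (\<Sum>j\<in>I. f j x)) \<le> L2_norm M (f i) + L2_norm M (\<lambda>x. \<Sum>j\<in>I. f j x)"
    by (intro L2_norm_triangle L2_space_sum) auto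
  with insert show ?case by simp
qed (auto simp: L2_norm_def)

section \<open>Completeness\<close>

text \<open>
  Riesz--Fischer for absolutely convergent series. The squared partial sums of the moduli increase
  and their integrals are bounded by the square of the sum of the norms, so by monotone convergence
  their supremum is integrable and hence finite almost everywhere. The sum of the series is the pointwise one,
  with the default value of a divergent series on the exceptional null set.
\<close>

theorem L2_series_converges:
  assumes f: "\<And>k. f k \<in> L2_space M" and s: "summable (\<lambda>k::nat. L2_norm M (f k))"
  shows "AE x in M. summable (\<lambda>k. cmod (f k x))"
    and "(\<lambda>x. \<Sum>k. f k x) \<in> L2_space M"
    and "L2_norm M (\<lambda>x. \<Sum>k. f k x) \<le> (\<Sum>k. L2_norm M (f k))"
proof -
  have [measurable]: "f k \<in> borel_measurable M" for k using f[of k] by (simp add: L2_space_def)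
  define K where "K = (\<Sum>k. L2_norm M (f k))"
  have K: "0 \<le> K" unfolding K_def by (intro suminf_nonneg s) auto
  define g where "g n x = (\<Sum>k<n. cmod (f k x))" for n x
  have g0: "0 \<le> g n x" for n x unfolding g_def by (intro sum_nonneg) auto
  have ginc: "g n x \<le> g m x" if "n \<le> m" for n m x
    unfolding g_def by (intro sum_mono2) (use that in auto)
  have gm [measurable]: "g n \<in> borel_measurable M" for n unfolding g_def by measurable
  have gL: "(\<lambda>x. complex_of_real (g n x)) \<in> L2_space M" for n
    unfolding g_def of_real_sum by (intro L2_space_intros f)
  have gn: "L2_norm M (\<lambda>x. complex_of_real (g n x)) \<le> K" for n
  proof -
    have "L2_norm M (\<lambda>x. complex_of_real (g n x)) \<le> (\<Sum>k<n. L2_norm M (f k))"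
      using L2_norm_sum[of "{..<n}" "\<lambda>k x. complex_of_real (cmod (f k x))" M]
      by (simp add: g_def L2_space_cmod f)
    also have "\<dots> \<le> K" unfolding K_def by (intro sum_le_suminf s) auto
    finally show ?thesis .
  qed
  have gi: "(\<integral>\<^sup>+x. ennreal ((g n x)\<^sup>2) \<partial>M) \<le> ennreal (K\<^sup>2)" for n
  proof -
    have "integrable M (\<lambda>x. (g n x)\<^sup>2)" using L2_space_integrable[OF gL[of n]] by simp
    then have "(\<integral>\<^sup>+x. ennreal ((g n x)\<^sup>2) \<partial>M) = ennreal (LINT x|M. (g n x)\<^sup>2)"
      by (intro nn_integral_eq_integral) auto
    also have "(LINT x|M. (g n x)\<^sup>2) = (L2_norm M (\<lambda>x. complex_of_real (g n x)))\<^sup>2"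
      by (simp add: L2_norm_square)
    also have "\<dots> \<le> K\<^sup>2" by (intro power_mono gn) simp
    finally show ?thesis by (simp add: ennreal_leI)
  qed
  define G where "G x = (SUP n. ennreal ((g n x)\<^sup>2))" for x
  have Gm [measurable]: "G \<in> borel_measurable M" unfolding G_def by measurable
  have "(\<integral>\<^sup>+x. G x \<partial>M) = (SUP n. \<integral>\<^sup>+x. ennreal ((g n x)\<^sup>2) \<partial>M)"
    unfolding G_def
    by (intro nn_integral_monotone_convergence_SUP)
      (auto simp: incseq_def le_fun_def intro!: ennreal_leI power_mono ginc g0)
  also have "\<dots> \<le> ennreal (K\<^sup>2)" by (intro SUP_least gi)
  finally have GK: "(\<integral>\<^sup>+x. G x \<partial>M) \<le> ennreal (K\<^sup>2)" .
  then have "(\<integral>\<^sup>+x. G x \<partial>M) \<noteq> \<infinity>" by (auto simp: top_unique)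
  then have Gfin: "AE x in M. G x \<noteq> \<infinity>" by (intro nn_integral_PInf_AE) auto
  have pt: "summable (\<lambda>k. cmod (f k x)) \<and> ennreal ((cmod (\<Sum>k. f k x))\<^sup>2) \<le> G x"
    if fin: "G x \<noteq> \<infinity>" for x
  proof -
    obtain r where r: "0 \<le> r" "G x = ennreal r"
      using fin by (cases "G x" rule: ennreal_cases) auto
    have gr: "g n x \<le> sqrt r" for n
    proof -
      have "ennreal ((g n x)\<^sup>2) \<le> ennreal r"
        unfolding r(2)[symmetric] G_def by (rule SUP_upper) simp
      then have "(g n x)\<^sup>2 \<le> r" using r(1) by simp
      then show ?thesis by (rule real_le_rsqrt)
    qed
    have su: "summable (\<lambda>k. cmod (f k x))"
      using gr by (intro summableI_nonneg_bounded[where x="sqrt r"]) (auto simp: g_def)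
    have "cmod (\<Sum>k. f k x) \<le> (\<Sum>k. cmod (f k x))" by (rule summable_norm[OF su])
    also have "\<dots> \<le> sqrt r"
      by (rule suminf_le_const[OF su]) (use gr in \<open>auto simp: g_def\<close>)
    finally have "(cmod (\<Sum>k. f k x))\<^sup>2 \<le> (sqrt r)\<^sup>2" by (intro power_mono) auto
    with su r show ?thesis by (simp add: ennreal_leI)
  qed
  show "AE x in M. summable (\<lambda>k. cmod (f k x))" using Gfin by eventually_elim (use pt in blast)
  have Fm [measurable]: "(\<lambda>x. \<Sum>k. f k x) \<in> borel_measurable M" by measurable
  have "(\<integral>\<^sup>+x. ennreal ((cmod (\<Sum>k. f k x))\<^sup>2) \<partial>M) \<le> (\<integral>\<^sup>+x. G x \<partial>M)"
    by (rule nn_integral_mono_AE) (use Gfin pt in \<open>auto elim: eventually_mono\<close>)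
  with GK have FK: "(\<integral>\<^sup>+x. ennreal ((cmod (\<Sum>k. f k x))\<^sup>2) \<partial>M) \<le> ennreal (K\<^sup>2)" by (rule order_trans[rotated])
  then have int: "integrable M (\<lambda>x. (cmod (\<Sum>k. f k x))\<^sup>2)"
    by (intro integrableI_nonneg) (auto simp: less_top[symmetric] top_unique)
  then show "(\<lambda>x. \<Sum>k. f k x) \<in> L2_space M" by (simp add: L2_space_def)
  have "ennreal (LINT x|M. (cmod (\<Sum>k. f k x))\<^sup>2) \<le> ennreal (K\<^sup>2)"
    using FK int by (subst nn_integral_eq_integral[symmetric]) auto
  then have "(L2_norm M (\<lambda>x. \<Sum>k. f k x))\<^sup>2 \<le> K\<^sup>2" by (simp add: L2_norm_square)
  then show "L2_norm M (\<lambda>x. \<Sum>k. f k x) \<le> (\<Sum>k. L2_norm M (f k))"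
    unfolding K_def[symmetric] by (rule power2_le_imp_le) (rule K)
qed

text \<open>
  Convergence in norm: the bound on the norm of a sum, applied to the tails.
\<close>

lemma L2_series_limit:
  assumes f: "\<And>k. f k \<in> L2_space M" and s: "summable (\<lambda>k::nat. L2_norm M (f k))"
  shows "(\<lambda>n. L2_norm M (\<lambda>x. (\<Sum>k. f k x) - (\<Sum>k<n. f k x))) \<longlonglongrightarrow> 0"
proof (rule tendsto_sandwich[OF always_eventually always_eventually tendsto_const])
  show "\<forall>n. L2_norm M (\<lambda>x. (\<Sum>k. f k x) - (\<Sum>k<n. f k x)) \<le> (\<Sum>k. L2_norm M (f (k + n)))"
  proof
    fix n
    have s': "summable (\<lambda>k. L2_norm M (f (k + n)))"
      using s summable_iff_shift[of "\<lambda>k. L2_norm M (f k)" n] by blast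
    have "AE x in M. (\<Sum>k. f k x) - (\<Sum>k<n. f k x) = (\<Sum>k. f (k + n) x)"
      using L2_series_converges(1)[OF f s]
    proof eventually_elim
      case (elim x)
      show ?case
        using suminf_split_initial_segment[OF summable_norm_cancel[OF elim], of n] by simp
    qed
    then have "L2_norm M (\<lambda>x. (\<Sum>k. f k x) - (\<Sum>k<n. f k x)) = L2_norm M (\<lambda>x. \<Sum>k. f (k + n) x)"
      by (intro L2_norm_cong L2_space_diff L2_space_sum L2_series_converges(2) f s s')
    also have "\<dots> \<le> (\<Sum>k. L2_norm M (f (k + n)))" by (rule L2_series_converges(3)[OF f s'])
    finally show "L2_norm M (\<lambda>x. (\<Sum>k. f k x) - (\<Sum>k<n. f k x)) \<le> (\<Sum>k. L2_norm M (f (k + n)))" .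
  qed
  show "(\<lambda>n. \<Sum>k. L2_norm M (f (k + n))) \<longlonglongrightarrow> 0" by (rule suminf_exist_split2[OF s])
qed simp

section \<open>Bounded operators and the operator norm\<close>

lemma L2_op_closed: "L2_bounded_operator M T \<Longrightarrow> f \<in> L2_space M \<Longrightarrow> T f \<in> L2_space M"
  by (simp add: L2_bounded_operator_def)

lemma L2_op_cong:
  "L2_bounded_operator M T \<Longrightarrow> f \<in> L2_space M \<Longrightarrow> g \<in> L2_space M \<Longrightarrow> AE x in M. f x = g x \<Longrightarrow>
    AE x in M. T f x = T g x"
  by (simp add: L2_bounded_operator_def)

lemma L2_op_add:
  "L2_bounded_operator M T \<Longrightarrow> f \<in> L2_space M \<Longrightarrow> g \<in> L2_space M \<Longrightarrow>
    AE x in M. T (\<lambda>y. f y + g y) x = T f x + T g x"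
  by (simp add: L2_bounded_operator_def)

lemma L2_op_scale:
  "L2_bounded_operator M T \<Longrightarrow> f \<in> L2_space M \<Longrightarrow> AE x in M. T (\<lambda>y. c * f y) x = c * T f x"
  by (simp add: L2_bounded_operator_def)

lemma L2_op_divide:
  assumes T: "L2_bounded_operator M T" and f: "f \<in> L2_space M"
  shows "AE x in M. T (\<lambda>y. f y / c) x = T f x / c"
  using L2_op_scale[OF T f, of "inverse c"] by (simp add: divide_inverse mult.commute)

lemma L2_op_zero:
  assumes T: "L2_bounded_operator M T"
  shows "AE x in M. T (\<lambda>y. 0) x = 0"
  using L2_op_scale[OF T L2_space_zero, of 0] by simp

lemma L2_op_diff:
  assumes T: "L2_bounded_operator M T" and f: "f \<in> L2_space M" and g: "g \<in> L2_space M"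
  shows "AE x in M. T (\<lambda>y. f y - g y) x = T f x - T g x"
  using eventually_conj[OF L2_op_add[OF T f L2_space_scale[OF g, of "-1"]] L2_op_scale[OF T g, of "-1"]]
  by eventually_elim simp

lemma L2_op_sum:
  assumes T: "L2_bounded_operator M T"
  shows "(\<And>i. i \<in> I \<Longrightarrow> f i \<in> L2_space M) \<Longrightarrow>
    AE x in M. T (\<lambda>y. \<Sum>i\<in>I. f i y) x = (\<Sum>i\<in>I. T (f i) x)"
proof (induction I rule: infinite_finite_induct)
  case (insert i I)
  then have "AE x in M. T (\<lambda>y. \<Sum>i\<in>I. f i y) x = (\<Sum>i\<in>I. T (f i) x)" by auto
  moreover have "AE x in M. T (\<lambda>y. f i y + (\<Sum>i\<in>I. f i y)) x = T (f i) x + T (\<lambda>y. \<Sum>i\<in>I. f i y) x"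
    using insert by (intro L2_op_add[OF T] L2_space_sum) auto
  ultimately show ?case by eventually_elim (use insert(1,2) in simp)
qed (use L2_op_zero[OF T] in auto)

definition L2_opnorm :: "'a measure \<Rightarrow> 'a fun_op \<Rightarrow> real" where
  "L2_opnorm M T = Inf {C. 0 \<le> C \<and> (\<forall>f\<in>L2_space M. L2_norm M (T f) \<le> C * L2_norm M f)}"

lemma L2_opnorm_least:
  assumes "0 \<le> C" "\<And>f. f \<in> L2_space M \<Longrightarrow> L2_norm M (T f) \<le> C * L2_norm M f"
  shows "L2_opnorm M T \<le> C"
  unfolding L2_opnorm_def by (rule cInf_lower) (use assms in \<open>auto intro!: bdd_belowI[where m=0]\<close>)

lemma L2_opnorm_set_nonempty:
  assumes T: "L2_bounded_operator M T"
  shows "{C. 0 \<le> C \<and> (\<forall>f\<in>L2_space M. L2_norm M (T f) \<le> C * L2_norm M f)} \<noteq> {}"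
proof -
  obtain C where C: "\<forall>f\<in>L2_space M. L2_norm M (T f) \<le> C * L2_norm M f"
    using T unfolding L2_bounded_operator_def by blast
  have "L2_norm M (T f) \<le> \<bar>C\<bar> * L2_norm M f" if "f \<in> L2_space M" for f
    using C[rule_format, OF that] mult_right_mono[OF abs_ge_self[of C] L2_norm_nonneg[of M f]] by linarith
  then show ?thesis by (auto intro!: exI[of _ "\<bar>C\<bar>"])
qed

lemma L2_opnorm_nonneg:
  assumes T: "L2_bounded_operator M T"
  shows "0 \<le> L2_opnorm M T"
  unfolding L2_opnorm_def by (rule cInf_greatest[OF L2_opnorm_set_nonempty[OF T]]) auto

text \<open>
  Division by the norm of \<open>f\<close> is impossible when \<open>f\<close> vanishes almost everywhere; then any finite
  bound of \<open>T\<close> shows that \<open>T f\<close> vanishes too.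
\<close>

lemma L2_opnorm_bound:
  assumes T: "L2_bounded_operator M T" and f: "f \<in> L2_space M"
  shows "L2_norm M (T f) \<le> L2_opnorm M T * L2_norm M f"
proof (cases "L2_norm M f = 0")
  case True
  obtain C where "\<forall>f\<in>L2_space M. L2_norm M (T f) \<le> C * L2_norm M f"
    using T unfolding L2_bounded_operator_def by blast
  from this[rule_format, OF f] True show ?thesis by simp
next
  case False
  then have p: "0 < L2_norm M f" using L2_norm_nonneg[of M f] by linarith
  have "L2_norm M (T f) / L2_norm M f \<le> L2_opnorm M T"
    unfolding L2_opnorm_def
    by (rule cInf_greatest[OF L2_opnorm_set_nonempty[OF T]]) (use p f in \<open>auto simp: pos_divide_le_eq\<close>)
  then show ?thesis using p by (simp add: pos_divide_le_eq)
qed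

text \<open>
  Continuity of \<open>T\<close> on partial sums. It allows the two identities that define a resolvent to be
  checked on the pointwise Neumann series.
\<close>

lemma L2_op_series:
  assumes T: "L2_bounded_operator M T"
    and f: "\<And>k. f k \<in> L2_space M" and s: "summable (\<lambda>k::nat. L2_norm M (f k))"
  shows "AE x in M. T (\<lambda>y. \<Sum>k. f k y) x = (\<Sum>k. T (f k) x)"
proof -
  let ?F = "\<lambda>y. \<Sum>k. f k y" and ?G = "\<lambda>x. \<Sum>k. T (f k) x"
  let ?s = "\<lambda>n y. \<Sum>k<n. f k y" and ?t = "\<lambda>n x. \<Sum>k<n. T (f k) x"
  note Tf = L2_op_closed[OF T f]
  have sT: "summable (\<lambda>k. L2_norm M (T (f k)))"
    by (rule summable_comparison_test'[OF summable_mult[OF s, of "L2_opnorm M T"], of 0])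
      (use L2_opnorm_bound[OF T f] in auto)
  have F: "?F \<in> L2_space M" and G: "?G \<in> L2_space M"
    using L2_series_converges(2)[OF f s] L2_series_converges(2)[OF Tf sT] by auto
  have sn: "?s n \<in> L2_space M" and tn: "?t n \<in> L2_space M" for n
    by (auto intro: L2_space_sum f Tf)
  have D: "(\<lambda>x. T ?F x - ?G x) \<in> L2_space M" by (intro L2_space_diff L2_op_closed[OF T] F G)
  have "L2_norm M (\<lambda>x. T ?F x - ?G x)
      \<le> L2_opnorm M T * L2_norm M (\<lambda>x. ?F x - ?s n x) + L2_norm M (\<lambda>x. ?G x - ?t n x)" for n
  proof -
    have FS: "(\<lambda>x. ?F x - ?s n x) \<in> L2_space M" and GS: "(\<lambda>x. ?G x - ?t n x) \<in> L2_space M"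
      by (intro L2_space_diff F G sn tn)+
    have 1: "AE x in M. T (\<lambda>x. ?F x - ?s n x) x = T ?F x - T (?s n) x"
      by (rule L2_op_diff[OF T F sn])
    have 2: "AE x in M. T (?s n) x = ?t n x" by (rule L2_op_sum[OF T f])
    have "AE x in M. T ?F x - ?G x = T (\<lambda>x. ?F x - ?s n x) x - (?G x - ?t n x)"
      using 1 2 by eventually_elim simp
    then have "L2_norm M (\<lambda>x. T ?F x - ?G x) = L2_norm M (\<lambda>x. T (\<lambda>x. ?F x - ?s n x) x - (?G x - ?t n x))"
      by (intro L2_norm_cong D L2_space_diff[OF L2_op_closed[OF T FS] GS])
    also have "\<dots> \<le> L2_norm M (T (\<lambda>x. ?F x - ?s n x)) + L2_norm M (\<lambda>x. ?G x - ?t n x)"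
      by (rule L2_norm_triangle_diff[OF L2_op_closed[OF T FS] GS])
    finally show ?thesis using L2_opnorm_bound[OF T FS] by linarith
  qed
  moreover have "(\<lambda>n. L2_opnorm M T * L2_norm M (\<lambda>x. ?F x - ?s n x) + L2_norm M (\<lambda>x. ?G x - ?t n x))
      \<longlonglongrightarrow> L2_opnorm M T * 0 + 0"
    by (intro tendsto_intros L2_series_limit f s Tf sT)
  ultimately have "L2_norm M (\<lambda>x. T ?F x - ?G x) \<le> 0" by (intro LIMSEQ_le_const) auto
  then have "AE x in M. T ?F x - ?G x = 0"
    using L2_norm_eq_0_iff[OF D] L2_norm_nonneg[of M "\<lambda>x. T ?F x - ?G x"] by simp
  then show ?thesis by eventually_elim simp
qed

lemma L2_bounded_operator_comp:
  assumes S: "L2_bounded_operator M S" and T: "L2_bounded_operator M T"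
  shows "L2_bounded_operator M (S \<circ> T)"
  unfolding L2_bounded_operator_def
proof (intro conjI ballI allI impI)
  fix f assume f: "f \<in> L2_space M"
  note Tf = L2_op_closed[OF T f]
  show "(S \<circ> T) f \<in> L2_space M" by (simp add: L2_op_closed[OF S Tf])
  show "AE x in M. (S \<circ> T) (\<lambda>y. c * f y) x = c * (S \<circ> T) f x" for c
    using L2_op_cong[OF S L2_op_closed[OF T L2_space_scale[OF f]] L2_space_scale[OF Tf] L2_op_scale[OF T f, of c]]
      L2_op_scale[OF S Tf, of c]
    unfolding o_def by eventually_elim simp
  fix g assume g: "g \<in> L2_space M"
  note Tg = L2_op_closed[OF T g]
  show "AE x in M. (S \<circ> T) (\<lambda>y. f y + g y) x = (S \<circ> T) f x + (S \<circ> T) g x"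
    using L2_op_cong[OF S L2_op_closed[OF T L2_space_add[OF f g]] L2_space_add[OF Tf Tg] L2_op_add[OF T f g]]
      L2_op_add[OF S Tf Tg]
    unfolding o_def by eventually_elim simp
  show "AE x in M. (S \<circ> T) f x = (S \<circ> T) g x" if "AE x in M. f x = g x"
    using L2_op_cong[OF S Tf Tg L2_op_cong[OF T f g that]] by simp
next
  have "L2_norm M ((S \<circ> T) f) \<le> L2_opnorm M S * L2_opnorm M T * L2_norm M f"
    if f: "f \<in> L2_space M" for f
    using L2_opnorm_bound[OF S L2_op_closed[OF T f]]
      mult_left_mono[OF L2_opnorm_bound[OF T f] L2_opnorm_nonneg[OF S]] by (simp add: mult.assoc)
  then show "\<exists>C. \<forall>f\<in>L2_space M. L2_norm M ((S \<circ> T) f) \<le> C * L2_norm M f" by blast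
qed

lemma L2_opnorm_comp:
  assumes S: "L2_bounded_operator M S" and T: "L2_bounded_operator M T"
  shows "L2_opnorm M (S \<circ> T) \<le> L2_opnorm M S * L2_opnorm M T"
proof (rule L2_opnorm_least)
  show "0 \<le> L2_opnorm M S * L2_opnorm M T" by (simp add: L2_opnorm_nonneg S T)
  show "L2_norm M ((S \<circ> T) f) \<le> L2_opnorm M S * L2_opnorm M T * L2_norm M f"
    if f: "f \<in> L2_space M" for f
    using L2_opnorm_bound[OF S L2_op_closed[OF T f]]
      mult_left_mono[OF L2_opnorm_bound[OF T f] L2_opnorm_nonneg[OF S]] by (simp add: mult.assoc)
qed

lemma L2_bounded_operator_funpow:
  assumes T: "L2_bounded_operator M T"
  shows "L2_bounded_operator M (T ^^ n)"
proof (induction n)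
  case 0
  then show ?case by (auto simp: L2_bounded_operator_def intro!: exI[of _ 1])
next
  case (Suc n)
  then show ?case using L2_bounded_operator_comp[OF T Suc] by (simp only: funpow.simps)
qed

section \<open>The Hilbert space adjoint\<close>

text \<open>
  The representing vector minimizes \<open>J h = \<parallel>h\<parallel>\<^sup>2 - 2 Re (\<phi> h)\<close>. The parallelogram identity bounds the
  distance of two almost minimizers by their defects (\<open>close\<close>), so a minimizing sequence with defects
  \<open>(1 / 4) ^ n\<close> has summable increments and converges. At a minimum \<open>H\<close> the derivative of \<open>J\<close> in each
  direction \<open>f\<close> vanishes, which says \<open>Re \<langle>f, H\<rangle> = Re (\<phi> f)\<close>; the direction \<open>\<i> f\<close> gives the imaginary
  parts.
\<close>

theorem L2_Riesz_representation:
  assumes add: "\<And>f g. f \<in> L2_space M \<Longrightarrow> g \<in> L2_space M \<Longrightarrow> \<phi> (\<lambda>x. f x + g x) = \<phi> f + \<phi> g"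
    and scale: "\<And>c f. f \<in> L2_space M \<Longrightarrow> \<phi> (\<lambda>x. c * f x) = c * \<phi> f"
    and bound: "\<And>f. f \<in> L2_space M \<Longrightarrow> cmod (\<phi> f) \<le> C * L2_norm M f"
  obtains h where "h \<in> L2_space M" "\<And>f. f \<in> L2_space M \<Longrightarrow> \<phi> f = L2_inner M f h"
proof -
  \<comment> \<open>A linear functional bounded by \<open>C\<close> keeps \<open>J\<close> above \<open>- C\<^sup>2\<close>, so the infimum exists.\<close>
  define J where "J h = (L2_norm M h)\<^sup>2 - 2 * Re (\<phi> h)" for h
  have J_below: "- C\<^sup>2 \<le> J h" if "h \<in> L2_space M" for h
  proof -
    have "Re (\<phi> h) \<le> C * L2_norm M h"
      using bound[OF that] complex_Re_le_cmod[of "\<phi> h"] by linarith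
    then show ?thesis
      using sum_squares_bound[of C "L2_norm M h"] by (simp add: J_def)
  qed
  have J_bdd: "bdd_below (J ` L2_space M)" by (rule bdd_belowI2[OF J_below])
  define d where "d = Inf (J ` L2_space M)"
  have d_le: "d \<le> J h" if "h \<in> L2_space M" for h
    unfolding d_def by (intro cInf_lower J_bdd imageI that)
  have "\<exists>h\<in>L2_space M. J h < d + (1 / 4) ^ n" for n :: nat
  proof -
    have "Inf (J ` L2_space M) < d + (1 / 4) ^ n" by (simp add: d_def)
    then have "\<exists>y\<in>J ` L2_space M. y < d + (1 / 4) ^ n"
      using L2_space_zero by (subst (asm) cInf_less_iff[OF _ J_bdd]) auto
    then show ?thesis by auto
  qed
  then obtain h where hL: "\<And>n. h n \<in> L2_space M" and hJ: "\<And>n. J (h n) < d + (1 / 4) ^ n"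
    by metis
  have J_shift: "J (\<lambda>x. u x + c * f x)
      = J u + 2 * Re (cnj c * L2_inner M u f) - 2 * Re (c * \<phi> f) + (cmod c)\<^sup>2 * (L2_norm M f)\<^sup>2"
    if "u \<in> L2_space M" "f \<in> L2_space M" for u f c
    using L2_norm_add_square[OF that, of c] add[OF that(1) L2_space_scale[OF that(2), of c]]
      scale[OF that(2), of c]
    by (simp add: J_def)
  have close: "(L2_norm M (\<lambda>x. v x - u x))\<^sup>2 \<le> 2 * (J u - d) + 2 * (J v - d)"
    if u: "u \<in> L2_space M" and v: "v \<in> L2_space M" for u v
  proof -
    let ?w = "\<lambda>x. v x - u x"
    have w: "?w \<in> L2_space M" by (intro L2_space_intros u v)
    have "d \<le> J (\<lambda>x. u x + (1/2) * ?w x)"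
      by (rule d_le) (intro L2_space_add L2_space_scale u w)
    also have "\<dots> = J u + Re (L2_inner M u ?w) - Re (\<phi> ?w) + (L2_norm M ?w)\<^sup>2 / 4"
      by (subst J_shift[OF u w]) (simp add: power_divide)
    finally have 1: "d \<le> J u + Re (L2_inner M u ?w) - Re (\<phi> ?w) + (L2_norm M ?w)\<^sup>2 / 4" .
    have 2: "J v = J u + 2 * Re (L2_inner M u ?w) - 2 * Re (\<phi> ?w) + (L2_norm M ?w)\<^sup>2"
      using J_shift[OF u w, of 1] by simp
    from 1 2 show ?thesis by argo
  qed
  \<comment> \<open>The increments, with \<open>h 0\<close> in front so that the partial sums are the \<open>h n\<close>.\<close>
  define g where "g k x = (if k = 0 then h 0 x else h k x - h (k - 1) x)" for k x
  have g_simps: "g 0 = h 0" "\<And>k. g (Suc k) = (\<lambda>x. h (Suc k) x - h k x)"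
    by (auto simp: g_def fun_eq_iff)
  have gL: "g k \<in> L2_space M" for k
    by (cases k) (auto simp: g_simps intro!: L2_space_diff hL)
  have g_norm: "L2_norm M (g (Suc k)) \<le> 2 * (1 / 2) ^ k" for k
  proof (rule power2_le_imp_le)
    have "(L2_norm M (g (Suc k)))\<^sup>2 \<le> 2 * (J (h k) - d) + 2 * (J (h (Suc k)) - d)"
      unfolding g_simps by (rule close[OF hL hL])
    also have "\<dots> \<le> 2 * (1 / 4) ^ k + 2 * (1 / 4) ^ k"
    proof -
      have "J (h (Suc k)) < d + (1 / 4) ^ k" by (rule less_le_trans[OF hJ]) simp
      then have "J (h k) - d \<le> (1 / 4) ^ k" "J (h (Suc k)) - d \<le> (1 / 4) ^ k"
        using hJ[of k] by (simp_all add: algebra_simps)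
      then show ?thesis by (intro add_mono mult_left_mono) auto
    qed
    also have "\<dots> = (2 * (1 / 2) ^ k)\<^sup>2"
      by (simp add: power_mult_distrib power2_eq_square flip: power_mult_distrib)
    finally show "(L2_norm M (g (Suc k)))\<^sup>2 \<le> (2 * (1 / 2) ^ k)\<^sup>2" .
  qed simp
  have geo: "summable (\<lambda>k. 2 * (1 / 2 :: real) ^ k)" by (intro summable_mult summable_geometric) simp
  have sg: "summable (\<lambda>k. L2_norm M (g k))"
    by (subst summable_Suc_iff[symmetric], rule summable_comparison_test'[OF geo, of 0])
      (use g_norm in auto)
  define H where "H x = (\<Sum>k. g k x)" for x
  have HL: "H \<in> L2_space M" unfolding H_def by (rule L2_series_converges(2)[OF gL sg])
  have "(\<Sum>k<Suc n. g k x) = h n x" for n x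
    by (induction n) (simp_all add: g_simps)
  then have near0: "(\<lambda>n. L2_norm M (\<lambda>x. H x - h n x)) \<longlonglongrightarrow> 0"
    using LIMSEQ_Suc[OF L2_series_limit[OF gL sg]] by (simp only: H_def)
  have JH: "J H \<le> d"
  proof -
    let ?e = "\<lambda>n. L2_norm M (\<lambda>x. H x - h n x)"
    have "J H \<le> d + (1/4) ^ n + (2 * L2_norm M H * ?e n + 2 * C * ?e n)" for n
    proof -
      have w: "(\<lambda>x. H x - h n x) \<in> L2_space M" by (intro L2_space_diff HL hL)
      have "J (h n) = J H - 2 * Re (L2_inner M H (\<lambda>x. H x - h n x)) + 2 * Re (\<phi> (\<lambda>x. H x - h n x))
          + (?e n)\<^sup>2"
        using J_shift[OF HL w, of "-1"] by simp
      moreover have "Re (L2_inner M H (\<lambda>x. H x - h n x)) \<le> L2_norm M H * ?e n"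
        using L2_Cauchy_Schwarz[OF HL w] complex_Re_le_cmod order_trans by blast
      moreover have "- Re (\<phi> (\<lambda>x. H x - h n x)) \<le> C * ?e n"
        using bound[OF w] abs_Re_le_cmod[of "\<phi> (\<lambda>x. H x - h n x)"] by linarith
      moreover have "0 \<le> (?e n)\<^sup>2" by simp
      ultimately have "J H \<le> J (h n) + (2 * (L2_norm M H * ?e n) + 2 * (C * ?e n))" by linarith
      then show ?thesis using hJ[of n] by (simp add: mult.assoc)
    qed
    moreover have "(\<lambda>n. d + (1/4) ^ n + (2 * L2_norm M H * ?e n + 2 * C * ?e n))
        \<longlonglongrightarrow> d + 0 + (2 * L2_norm M H * 0 + 2 * C * 0)"
      by (intro tendsto_intros near0 LIMSEQ_realpow_zero) auto
    ultimately show ?thesis by (intro LIMSEQ_le_const) auto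
  qed
  have Re_eq: "Re (L2_inner M f H) = Re (\<phi> f)" if f: "f \<in> L2_space M" for f
  proof -
    let ?a = "Re (L2_inner M f H) - Re (\<phi> f)" and ?b = "(L2_norm M f)\<^sup>2"
    have q: "0 \<le> 2 * s * ?a + s\<^sup>2 * ?b" for s :: real
    proof -
      have "J H \<le> J (\<lambda>x. H x + of_real s * f x)"
        by (rule order_trans[OF JH d_le]) (intro L2_space_add L2_space_scale HL f)
      then show ?thesis
        unfolding J_shift[OF HL f] by (simp add: L2_inner_commute[of M H f] algebra_simps)
    qed
    have "?a = 0"
    proof (rule ccontr)
      assume a: "?a \<noteq> 0"
      \<comment> \<open>Near the minimum of the quadratic in \<open>s\<close>; the summand \<open>1\<close> covers \<open>\<parallel>f\<parallel> = 0\<close>.\<close>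
      let ?s = "- ?a / (?b + 1)"
      have b1: "?b + 1 > 0" by (simp add: add_nonneg_pos)
      have "0 \<le> 2 * ?s * ?a + ?s\<^sup>2 * ?b" by (rule q)
      also have "\<dots> \<le> 2 * ?s * ?a + ?s\<^sup>2 * (?b + 1)" by (simp add: mult_left_mono)
      also have "\<dots> = - (?a\<^sup>2 / (?b + 1))"
        using b1 by (simp add: power2_eq_square divide_simps) (simp add: algebra_simps)
      also have "\<dots> < 0" using a b1 by simp
      finally show False by simp
    qed
    then show ?thesis by simp
  qed
  show thesis
  proof (rule that[OF HL])
    fix f assume f: "f \<in> L2_space M"
    have "Re (L2_inner M (\<lambda>x. \<i> * f x) H) = Re (\<phi> (\<lambda>x. \<i> * f x))"
      by (rule Re_eq[OF L2_space_scale[OF f]])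
    then have "Im (L2_inner M f H) = Im (\<phi> f)"
      by (simp add: L2_inner_scale_left scale[OF f])
    with Re_eq[OF f] show "\<phi> f = L2_inner M f H" by (simp add: complex_eq_iff)
  qed
qed

text \<open>
  The functional \<open>f \<mapsto> \<langle>T f, g\<rangle>\<close> is bounded, so the choice in the definition of the adjoint succeeds.
\<close>

lemma L2_adjoint:
  assumes T: "L2_bounded_operator M T" and g: "g \<in> L2_space M"
  shows L2_adjoint_closed: "L2_adjoint M T g \<in> L2_space M"
    and L2_adjoint_inner: "f \<in> L2_space M \<Longrightarrow> L2_inner M (T f) g = L2_inner M f (L2_adjoint M T g)"
proof -
  have "\<exists>h. h \<in> L2_space M \<and> (\<forall>f\<in>L2_space M. L2_inner M (T f) g = L2_inner M f h)"
  proof (rule L2_Riesz_representation[of M "\<lambda>f. L2_inner M (T f) g" "L2_opnorm M T * L2_norm M g"])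
    fix f assume f: "f \<in> L2_space M"
    note Tf = L2_op_closed[OF T f]
    show "L2_inner M (T (\<lambda>x. c * f x)) g = c * L2_inner M (T f) g" for c
      using L2_inner_congL[OF L2_op_closed[OF T L2_space_scale[OF f]] L2_space_scale[OF Tf] L2_op_scale[OF T f] g]
      by (simp add: L2_inner_scale_left)
    show "cmod (L2_inner M (T f) g) \<le> L2_opnorm M T * L2_norm M g * L2_norm M f"
      using L2_Cauchy_Schwarz[OF Tf g] mult_right_mono[OF L2_opnorm_bound[OF T f] L2_norm_nonneg[of M g]]
      by (simp add: mult_ac)
    fix f' assume f': "f' \<in> L2_space M"
    note Tf' = L2_op_closed[OF T f']
    show "L2_inner M (T (\<lambda>x. f x + f' x)) g = L2_inner M (T f) g + L2_inner M (T f') g"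
      using L2_inner_congL[OF L2_op_closed[OF T L2_space_add[OF f f']] L2_space_add[OF Tf Tf'] L2_op_add[OF T f f'] g]
      by (simp add: L2_inner_add_left Tf Tf' g)
  qed blast
  then have "L2_adjoint M T g \<in> L2_space M \<and>
      (\<forall>f\<in>L2_space M. L2_inner M (T f) g = L2_inner M f (L2_adjoint M T g))"
    unfolding L2_adjoint_def by (rule someI_ex)
  then show "L2_adjoint M T g \<in> L2_space M"
    and "f \<in> L2_space M \<Longrightarrow> L2_inner M (T f) g = L2_inner M f (L2_adjoint M T g)" by auto
qed

lemma L2_inner_eqI:
  assumes u: "u \<in> L2_space M" and v: "v \<in> L2_space M"
    and eq: "\<And>f. f \<in> L2_space M \<Longrightarrow> L2_inner M f u = L2_inner M f v"
  shows "AE x in M. u x = v x"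
proof -
  let ?w = "\<lambda>x. u x - v x"
  have w: "?w \<in> L2_space M" by (rule L2_space_diff[OF u v])
  have "L2_inner M ?w ?w = 0" by (subst L2_inner_diff_right[OF u v w]) (simp add: eq[OF w])
  then have "L2_norm M ?w = 0" by (simp add: L2_inner_self)
  then show ?thesis using L2_norm_eq_0_iff[OF w] by simp
qed

text \<open>
  \<open>\<parallel>T\<^sup>* g\<parallel>\<^sup>2 = \<langle>T (T\<^sup>* g), g\<rangle> \<le> \<parallel>T\<parallel> \<parallel>T\<^sup>* g\<parallel> \<parallel>g\<parallel>\<close>.
\<close>

lemma L2_adjoint_bound:
  assumes T: "L2_bounded_operator M T" and g: "g \<in> L2_space M"
  shows "L2_norm M (L2_adjoint M T g) \<le> L2_opnorm M T * L2_norm M g"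
proof -
  let ?h = "L2_adjoint M T g"
  have h: "?h \<in> L2_space M" by (rule L2_adjoint_closed[OF T g])
  have "(L2_norm M ?h)\<^sup>2 = cmod (L2_inner M ?h ?h)" by (simp add: L2_inner_self norm_power)
  also have "\<dots> = cmod (L2_inner M (T ?h) g)" by (simp add: L2_adjoint_inner[OF T g h])
  also have "\<dots> \<le> L2_norm M (T ?h) * L2_norm M g" by (rule L2_Cauchy_Schwarz[OF L2_op_closed[OF T h] g])
  also have "\<dots> \<le> L2_opnorm M T * L2_norm M ?h * L2_norm M g"
    by (intro mult_right_mono L2_opnorm_bound[OF T h]) simp
  finally have *: "L2_norm M ?h * L2_norm M ?h \<le> (L2_opnorm M T * L2_norm M g) * L2_norm M ?h"
    by (simp add: power2_eq_square mult_ac)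
  show ?thesis
  proof (cases "L2_norm M ?h = 0")
    case True
    then show ?thesis by (simp add: L2_opnorm_nonneg[OF T])
  next
    case False
    then have "0 < L2_norm M ?h" using L2_norm_nonneg[of M ?h] by linarith
    then show ?thesis using * by (simp only: mult_le_cancel_right_pos)
  qed
qed

text \<open>
  The values of the adjoint are only determined almost everywhere; linearity and compatibility with
  almost-everywhere equality follow because inner products determine a function up to null sets.
\<close>

lemma L2_adjoint_bounded_operator:
  assumes T: "L2_bounded_operator M T"
  shows "L2_bounded_operator M (L2_adjoint M T)"
  unfolding L2_bounded_operator_def
proof (intro conjI ballI allI impI)
  note closed = L2_adjoint_closed[OF T] and inner = L2_adjoint_inner[OF T, symmetric]
  fix f assume f: "f \<in> L2_space M"
  show "L2_adjoint M T f \<in> L2_space M" by (rule closed[OF f])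
  show "AE x in M. L2_adjoint M T (\<lambda>y. c * f y) x = c * L2_adjoint M T f x" for c
    by (rule L2_inner_eqI)
      (use f in \<open>auto simp: inner L2_inner_scale_right L2_space_scale closed\<close>)
  fix g assume g: "g \<in> L2_space M"
  show "AE x in M. L2_adjoint M T (\<lambda>y. f y + g y) x = L2_adjoint M T f x + L2_adjoint M T g x"
    by (rule L2_inner_eqI)
      (use f g in \<open>auto simp: inner L2_inner_add_right L2_space_add L2_op_closed[OF T] closed\<close>)
  show "AE x in M. L2_adjoint M T f x = L2_adjoint M T g x" if "AE x in M. f x = g x"
    by (rule L2_inner_eqI)
      (use f g that in \<open>auto simp: inner closed intro!: L2_inner_congR L2_op_closed[OF T]\<close>)
next
  show "\<exists>C. \<forall>f\<in>L2_space M. L2_norm M (L2_adjoint M T f) \<le> C * L2_norm M f"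
    using L2_adjoint_bound[OF T] by blast
qed

section \<open>Positive operators\<close>

lemma nonneg_Reals_sum: "(\<And>i. i \<in> I \<Longrightarrow> f i \<in> \<real>\<^sub>\<ge>\<^sub>0) \<Longrightarrow> (\<Sum>i\<in>I. f i) \<in> \<real>\<^sub>\<ge>\<^sub>0"
  by (induction I rule: infinite_finite_induct) auto

lemma cmod_mono_nonneg_Reals:
  assumes "a \<in> \<real>\<^sub>\<ge>\<^sub>0" "b - a \<in> \<real>\<^sub>\<ge>\<^sub>0"
  shows "cmod a \<le> cmod b"
  using assms by (auto simp: complex_nonneg_Reals_iff cmod_eq_Re)

lemma L2_positiveD:
  "L2_positive M T \<Longrightarrow> f \<in> L2_space M \<Longrightarrow> AE x in M. f x \<in> \<real>\<^sub>\<ge>\<^sub>0 \<Longrightarrow> AE x in M. T f x \<in> \<real>\<^sub>\<ge>\<^sub>0"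
  by (simp add: L2_positive_def)

lemma L2_positive_comp:
  assumes S: "L2_positive M S" and T: "L2_bounded_operator M T" "L2_positive M T"
  shows "L2_positive M (S \<circ> T)"
  using assms by (auto simp: L2_positive_def L2_op_closed)

lemma L2_positive_funpow:
  assumes T: "L2_bounded_operator M T" "L2_positive M T"
  shows "L2_positive M (T ^^ n)"
proof (induction n)
  case 0
  then show ?case by (simp add: L2_positive_def)
next
  case (Suc n)
  then show ?case
    using L2_positive_comp[OF T(2) L2_bounded_operator_funpow[OF T(1)]] by (simp only: funpow.simps)
qed

lemma L2_positive_mono:
  assumes T: "L2_bounded_operator M T" "L2_positive M T"
    and f: "f \<in> L2_space M" and g: "g \<in> L2_space M" and le: "AE x in M. g x - f x \<in> \<real>\<^sub>\<ge>\<^sub>0"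
  shows "AE x in M. T g x - T f x \<in> \<real>\<^sub>\<ge>\<^sub>0"
  using eventually_conj[OF L2_positiveD[OF T(2) L2_space_diff[OF g f] le] L2_op_diff[OF T(1) g f]]
  by eventually_elim metis

text \<open>
  If \<open>f\<close> is real then \<open>f = |f| - (|f| - f)\<close> is a difference of nonnegative functions.
\<close>

lemma L2_positive_real:
  assumes T: "L2_bounded_operator M T" "L2_positive M T"
    and f: "f \<in> L2_space M" and r: "AE x in M. Im (f x) = 0"
  shows "AE x in M. Im (T f x) = 0"
proof -
  let ?a = "\<lambda>x. complex_of_real (cmod (f x))"
  have a: "?a \<in> L2_space M" by (rule L2_space_cmod[OF f])
  have "AE x in M. T ?a x \<in> \<real>\<^sub>\<ge>\<^sub>0" by (rule L2_positiveD[OF T(2) a]) simp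
  moreover have "AE x in M. ?a x - f x \<in> \<real>\<^sub>\<ge>\<^sub>0"
    using r by eventually_elim (simp add: complex_nonneg_Reals_iff complex_Re_le_cmod)
  then have "AE x in M. T ?a x - T f x \<in> \<real>\<^sub>\<ge>\<^sub>0" by (rule L2_positive_mono[OF T f a])
  ultimately show ?thesis by eventually_elim (auto simp: complex_nonneg_Reals_iff)
qed

text \<open>
  The modulus is the supremum of the real parts over all rotations, and by continuity over the
  countable set of rotations with rational angle. Countability lets the inequality pass through
  null sets.
\<close>

lemma cmod_le_rational_rotations:
  assumes "\<And>q :: rat. Re (cis (of_rat q) * z) \<le> a"
  shows "cmod z \<le> a"
proof -
  have "Re (cis (- Arg z) * z) \<le> a"
  proof (rule continuous_le_on_closure[where S = "\<rat> :: real set" and f = "\<lambda>t. Re (cis t * z)" and x = "- Arg z"])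
    show "continuous_on (closure \<rat>) (\<lambda>t. Re (cis t * z))"
      by (intro continuous_intros continuous_on_Re)
    show "- Arg z \<in> closure \<rat>" using Rats_closure_real by simp
    fix t :: real assume "t \<in> \<rat>"
    then show "Re (cis t * z) \<le> a" using assms by (metis Rats_cases)
  qed
  also have "cis (- Arg z) * z = of_real (cmod z)"
    using rcis_cmod_Arg[of z] by (metis cis_mult add.commute add.right_inverse cis_zero mult.assoc
        mult.commute mult.right_neutral rcis_def)
  finally show ?thesis by simp
qed

text \<open>
  For each fixed angle, \<open>Re (cis q * f) \<le> |f|\<close>; positivity and linearity transfer this to \<open>T f\<close> and
  \<open>T |f|\<close> off a null set, because \<open>T\<close> maps real functions to real functions and so commutes with taking real
  parts. Countably many angles suffice.
\<close>

lemma L2_positive_modulus: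
  assumes T: "L2_bounded_operator M T" "L2_positive M T" and f: "f \<in> L2_space M"
  shows "AE x in M. cmod (T f x) \<le> Re (T (\<lambda>x. of_real (cmod (f x))) x)"
proof -
  let ?a = "\<lambda>x. complex_of_real (cmod (f x))"
  have a: "?a \<in> L2_space M" by (rule L2_space_cmod[OF f])
  have "AE x in M. Re (cis (of_rat q) * T f x) \<le> Re (T ?a x)" for q :: rat
  proof -
    let ?w = "\<lambda>x. cis (of_rat q) * f x"
    let ?u = "\<lambda>x. complex_of_real (Re (?w x))" and ?v = "\<lambda>x. complex_of_real (Im (?w x))"
    have w: "?w \<in> L2_space M" by (rule L2_space_scale[OF f])
    note [measurable] = L2_space_measurable[OF w]
    have u: "?u \<in> L2_space M" by (rule L2_space_of_real[OF w]) (measurable, rule abs_Re_le_cmod)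
    have v: "?v \<in> L2_space M" by (rule L2_space_of_real[OF w]) (measurable, rule abs_Im_le_cmod)
    have iv: "(\<lambda>x. \<i> * ?v x) \<in> L2_space M" by (rule L2_space_scale[OF v])
    have "(\<lambda>x. ?u x + \<i> * ?v x) = ?w" by (simp add: fun_eq_iff complex_eq_iff)
    then have 1: "AE x in M. T ?w x = T ?u x + T (\<lambda>x. \<i> * ?v x) x"
      using L2_op_add[OF T(1) u iv] by simp
    have 2: "AE x in M. T (\<lambda>x. \<i> * ?v x) x = \<i> * T ?v x" by (rule L2_op_scale[OF T(1) v])
    have 3: "AE x in M. Im (T ?v x) = 0" by (rule L2_positive_real[OF T v]) simp
    have 4: "AE x in M. T ?w x = cis (of_rat q) * T f x" by (rule L2_op_scale[OF T(1) f])
    have "?a x - ?u x \<in> \<real>\<^sub>\<ge>\<^sub>0" for x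
      using complex_Re_le_cmod[of "?w x"] by (simp add: complex_nonneg_Reals_iff norm_mult)
    then have 5: "AE x in M. T ?a x - T ?u x \<in> \<real>\<^sub>\<ge>\<^sub>0" by (intro L2_positive_mono[OF T u a]) simp
    from 1 2 3 4 5 show ?thesis
      by eventually_elim (auto simp: complex_nonneg_Reals_iff)
  qed
  then have "AE x in M. \<forall>q :: rat. Re (cis (of_rat q) * T f x) \<le> Re (T ?a x)"
    by (simp add: AE_all_countable)
  then show ?thesis by eventually_elim (blast intro: cmod_le_rational_rotations)
qed

lemma L2_positive_norm_modulus:
  assumes T: "L2_bounded_operator M T" "L2_positive M T" and f: "f \<in> L2_space M"
  shows "L2_norm M (T f) \<le> L2_norm M (T (\<lambda>x. of_real (cmod (f x))))"
proof (rule L2_norm_mono)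
  show "AE x in M. cmod (T f x) \<le> cmod (T (\<lambda>x. of_real (cmod (f x))) x)"
    using L2_positive_modulus[OF T f]
    by eventually_elim (use complex_Re_le_cmod order_trans in blast)
qed (use f T(1) in \<open>auto intro: L2_op_closed L2_space_cmod\<close>)

text \<open>
  \<open>\<parallel>T f\<parallel> \<le> \<parallel>T |f|\<parallel>\<close>, so the norm of a positive operator is determined by its values on nonnegative functions.
\<close>

lemma L2_opnorm_least_positive:
  assumes T: "L2_bounded_operator M T" "L2_positive M T" and C: "0 \<le> C"
    and b: "\<And>f. f \<in> L2_space M \<Longrightarrow> AE x in M. f x \<in> \<real>\<^sub>\<ge>\<^sub>0 \<Longrightarrow> L2_norm M (T f) \<le> C * L2_norm M f"
  shows "L2_opnorm M T \<le> C"
proof (rule L2_opnorm_least[OF C])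
  fix f assume f: "f \<in> L2_space M"
  have "L2_norm M (T (\<lambda>x. of_real (cmod (f x)))) \<le> C * L2_norm M (\<lambda>x. complex_of_real (cmod (f x)))"
    by (intro b L2_space_cmod f) simp
  then show "L2_norm M (T f) \<le> C * L2_norm M f"
    using L2_positive_norm_modulus[OF T f] by simp
qed

lemma L2_positive_quadratic_modulus:
  assumes T: "L2_bounded_operator M T" "L2_positive M T" and f: "f \<in> L2_space M"
  shows "cmod (L2_inner M (T f) f)
    \<le> Re (L2_inner M (T (\<lambda>x. of_real (cmod (f x)))) (\<lambda>x. of_real (cmod (f x))))"
proof -
  let ?a = "\<lambda>x. complex_of_real (cmod (f x))"
  have a: "?a \<in> L2_space M" by (rule L2_space_cmod[OF f])
  note int1 = L2_inner_integrable[OF L2_op_closed[OF T(1) f] f]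
  note int2 = L2_inner_integrable[OF L2_op_closed[OF T(1) a] a]
  have "cmod (L2_inner M (T f) f) \<le> (LINT x|M. cmod (T f x * cnj (f x)))"
    unfolding L2_inner_def by (rule integral_norm_bound)
  also have "\<dots> \<le> (LINT x|M. Re (T ?a x * cnj (?a x)))"
  proof (rule integral_mono_AE)
    show "AE x in M. cmod (T f x * cnj (f x)) \<le> Re (T ?a x * cnj (?a x))"
      using L2_positive_modulus[OF T f] by eventually_elim (simp add: norm_mult mult_right_mono)
  qed (rule integrable_norm[OF int1] integrable_Re[OF int2])+
  also have "\<dots> = Re (L2_inner M (T ?a) ?a)"
    unfolding L2_inner_def by (rule integral_Re[OF int2])
  finally show ?thesis .
qed

lemma L2_inner_nonneg:
  assumes f: "f \<in> L2_space M" "AE x in M. f x \<in> \<real>\<^sub>\<ge>\<^sub>0" and g: "g \<in> L2_space M" "AE x in M. g x \<in> \<real>\<^sub>\<ge>\<^sub>0"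
  shows "L2_inner M f g \<in> \<real>\<^sub>\<ge>\<^sub>0"
proof -
  note int = L2_inner_integrable[OF f(1) g(1)]
  have *: "AE x in M. Re (f x * cnj (g x)) \<ge> 0 \<and> Im (f x * cnj (g x)) = 0"
    using f(2) g(2) by eventually_elim (auto simp: complex_nonneg_Reals_iff)
  have "0 \<le> (LINT x|M. Re (f x * cnj (g x)))"
    by (rule integral_nonneg_AE) (use * in \<open>auto elim: eventually_mono\<close>)
  moreover have "(LINT x|M. Im (f x * cnj (g x))) = 0"
    by (rule integral_eq_zero_AE) (use * in \<open>auto elim: eventually_mono\<close>)
  ultimately show ?thesis
    using integral_Re[OF int] integral_Im[OF int] by (simp add: L2_inner_def complex_nonneg_Reals_iff)
qed

text \<open>
  Testing \<open>h\<close> against the positive part \<open>f\<close> of \<open>Re (c * cnj h)\<close> gives \<open>\<parallel>f\<parallel>\<^sup>2 = Re (c * \<langle>f, h\<rangle>) \<le> 0\<close>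
  whenever \<open>Re c \<le> 0\<close>. The three choices \<open>c = -1, \<i>, -\<i>\<close> confine \<open>h\<close> to the nonnegative half-line.
\<close>

lemma L2_nonneg_by_duality:
  assumes h: "h \<in> L2_space M"
    and dual: "\<And>f. f \<in> L2_space M \<Longrightarrow> AE x in M. f x \<in> \<real>\<^sub>\<ge>\<^sub>0 \<Longrightarrow> L2_inner M f h \<in> \<real>\<^sub>\<ge>\<^sub>0"
  shows "AE x in M. h x \<in> \<real>\<^sub>\<ge>\<^sub>0"
proof -
  note [measurable] = L2_space_measurable[OF h]
  have half_plane: "AE x in M. Re (c * cnj (h x)) \<le> 0" if c: "cmod c = 1" "Re c \<le> 0" for c
  proof -
    let ?u = "\<lambda>x. max 0 (Re (c * cnj (h x)))"
    let ?f = "\<lambda>x. complex_of_real (?u x)"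
    have f: "?f \<in> L2_space M"
    proof (rule L2_space_of_real[OF h])
      show "\<bar>?u x\<bar> \<le> cmod (h x)" for x
        using complex_Re_le_cmod[of "c * cnj (h x)"] c by (simp add: norm_mult)
    qed measurable
    have int: "integrable M (\<lambda>x. c * (?f x * cnj (h x)))"
      by (intro integrable_mult_right L2_inner_integrable f h)
    have "(L2_norm M ?f)\<^sup>2 = (LINT x|M. Re (c * (?f x * cnj (h x))))"
      unfolding L2_norm_square
    proof (rule Bochner_Integration.integral_cong[OF refl])
      show "(cmod (?f x))\<^sup>2 = Re (c * (?f x * cnj (h x)))" for x
      proof -
        have "c * (?f x * cnj (h x)) = of_real (?u x) * (c * cnj (h x))" by simp
        then have "Re (c * (?f x * cnj (h x))) = ?u x * Re (c * cnj (h x))"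
          by (simp only: Re_complex_of_real Im_complex_of_real times_complex.simps(1))
        then show ?thesis by (simp add: power2_eq_square max_def)
      qed
    qed
    also have "\<dots> = Re (c * L2_inner M ?f h)"
      using integral_Re[OF int] by (simp add: L2_inner_def)
    also have "\<dots> \<le> 0"
      using dual[OF f] c(2) by (simp add: complex_nonneg_Reals_iff mult_nonpos_nonneg)
    finally have "L2_norm M ?f = 0" by simp
    then have "AE x in M. ?f x = 0" using L2_norm_eq_0_iff[OF f] by blast
    then show ?thesis by eventually_elim (simp add: max_def split: if_splits)
  qed
  have "AE x in M. Re (- 1 * cnj (h x)) \<le> 0" "AE x in M. Re (\<i> * cnj (h x)) \<le> 0"
    "AE x in M. Re (- \<i> * cnj (h x)) \<le> 0" by (rule half_plane; simp)+
  then show ?thesis by eventually_elim (simp add: complex_nonneg_Reals_iff)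
qed

lemma L2_adjoint_positive:
  assumes T: "L2_bounded_operator M T" "L2_positive M T"
  shows "L2_positive M (L2_adjoint M T)"
  unfolding L2_positive_def
proof (intro ballI impI)
  fix g assume g: "g \<in> L2_space M" "AE x in M. g x \<in> \<real>\<^sub>\<ge>\<^sub>0"
  show "AE x in M. L2_adjoint M T g x \<in> \<real>\<^sub>\<ge>\<^sub>0"
  proof (rule L2_nonneg_by_duality[OF L2_adjoint_closed[OF T(1) g(1)]])
    fix f assume f: "f \<in> L2_space M" "AE x in M. f x \<in> \<real>\<^sub>\<ge>\<^sub>0"
    have "L2_inner M (T f) g \<in> \<real>\<^sub>\<ge>\<^sub>0"
      by (rule L2_inner_nonneg[OF L2_op_closed[OF T(1) f(1)] L2_positiveD[OF T(2) f] g])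
    then show "L2_inner M f (L2_adjoint M T g) \<in> \<real>\<^sub>\<ge>\<^sub>0" by (simp add: L2_adjoint_inner[OF T(1) g(1) f(1)])
  qed
qed

section \<open>The Neumann series\<close>

text \<open>
  The partial sums \<open>s n\<close> satisfy \<open>s n \<le> s (n + N) \<le> s N + q * s n\<close> and are therefore bounded.
\<close>

lemma summable_geometric_blocks:
  fixes c :: "nat \<Rightarrow> real"
  assumes c: "\<And>k. 0 \<le> c k" and q: "q < 1" and step: "\<And>k. c (k + N) \<le> q * c k"
  shows "summable c"
proof (rule summableI_nonneg_bounded[OF c])
  fix n
  have "(\<Sum>k<n. c k) \<le> (\<Sum>k<n + N. c k)" by (rule sum_mono2) (use c in auto)
  also have "\<dots> = (\<Sum>k<N. c k) + (\<Sum>k<n. c (k + N))"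
  proof -
    have "(\<Sum>k<n + N. c k) = (\<Sum>k\<in>{0..<N}. c k) + (\<Sum>k\<in>{N..<n + N}. c k)"
      by (simp add: lessThan_atLeast0 sum.atLeastLessThan_concat)
    also have "(\<Sum>k\<in>{N..<n + N}. c k) = (\<Sum>k<n. c (k + N))"
      using sum.shift_bounds_nat_ivl[of c 0 N n] by (simp add: lessThan_atLeast0)
    finally show ?thesis by (simp add: lessThan_atLeast0)
  qed
  also have "(\<Sum>k<n. c (k + N)) \<le> q * (\<Sum>k<n. c k)"
    unfolding sum_distrib_left by (rule sum_mono[OF step])
  finally have "(\<Sum>k<n. c k) * (1 - q) \<le> (\<Sum>k<N. c k)" by (simp add: algebra_simps)
  then show "(\<Sum>k<n. c k) \<le> (\<Sum>k<N. c k) / (1 - q)" using q by (simp add: pos_le_divide_eq)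
qed

lemma L2_opnorm_funpow_add:
  assumes T: "L2_bounded_operator M T"
  shows "L2_opnorm M (T ^^ (m + n)) \<le> L2_opnorm M (T ^^ m) * L2_opnorm M (T ^^ n)"
  unfolding funpow_add by (intro L2_opnorm_comp L2_bounded_operator_funpow T)

text \<open>
  The resolvent is the Neumann series \<open>\<Sum>k. T ^ k f / z ^ (k + 1)\<close>, summed pointwise almost
  everywhere. Its norms are summable because a single power \<open>T ^ N\<close> is smaller than \<open>z ^ N\<close>, which
  makes the terms decay geometrically over blocks of length \<open>N\<close>. Both resolvent identities reduce
  to the same telescoping series.
\<close>

theorem L2_not_in_spectrum:
  assumes T: "L2_bounded_operator M T" and N: "L2_opnorm M (T ^^ N) < cmod z ^ N" "0 < N"
  shows "z \<notin> L2_spectrum M T"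
proof -
  note Tn = L2_bounded_operator_funpow[OF T]
  have z: "z \<noteq> 0"
    using N L2_opnorm_nonneg[OF Tn[of N]] by (auto simp: zero_power)
  define c where "c k = L2_opnorm M (T ^^ k) / cmod z ^ k" for k
  have c0: "0 \<le> c k" for k unfolding c_def by (intro divide_nonneg_nonneg L2_opnorm_nonneg Tn) simp
  have sc: "summable c"
  proof (rule summable_geometric_blocks[OF c0])
    show "c N < 1" using N(1) z by (simp add: c_def)
    show "c (k + N) \<le> c N * c k" for k
      using L2_opnorm_funpow_add[OF T, of k N] z by (simp add: c_def field_simps power_add)
  qed
  define u where "u f k x = (T ^^ k) f x / z ^ Suc k" for f k and x :: 'a
  have uL: "u f k \<in> L2_space M" if "f \<in> L2_space M" for f k
    unfolding u_def by (intro L2_space_divide L2_op_closed[OF Tn] that)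
  have u_norm: "L2_norm M (u f k) \<le> c k * (L2_norm M f / cmod z)" if f: "f \<in> L2_space M" for f k
  proof -
    have "L2_norm M (u f k) = L2_norm M ((T ^^ k) f) / cmod z ^ Suc k"
      using L2_norm_scale[of M "inverse (z ^ Suc k)" "(T ^^ k) f"]
      by (simp add: u_def[abs_def] divide_inverse mult.commute norm_inverse norm_power norm_mult)
    also have "\<dots> \<le> (L2_opnorm M (T ^^ k) * L2_norm M f) / cmod z ^ Suc k"
      by (intro divide_right_mono L2_opnorm_bound[OF Tn f]) simp
    also have "\<dots> = c k * (L2_norm M f / cmod z)" by (simp add: c_def)
    finally show ?thesis .
  qed
  have su: "summable (\<lambda>k. L2_norm M (u f k))" if f: "f \<in> L2_space M" for f
    by (rule summable_comparison_test'[OF summable_mult2[OF sc, of "L2_norm M f / cmod z"], of 0]) (use u_norm[OF f] in auto)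
  define S where "S f x = (\<Sum>k. u f k x)" for f and x :: 'a
  have SL: "S f \<in> L2_space M" if f: "f \<in> L2_space M" for f
    unfolding S_def[abs_def] by (rule L2_series_converges(2)[OF uL[OF f] su[OF f]])
  have u_summable: "AE x in M. summable (\<lambda>k. u f k x)" if f: "f \<in> L2_space M" for f
    using L2_series_converges(1)[OF uL[OF f] su[OF f]] by eventually_elim (rule summable_norm_cancel)
  have S: "L2_bounded_operator M S"
    unfolding L2_bounded_operator_def
  proof (intro conjI ballI allI impI)
    fix f assume f: "f \<in> L2_space M"
    show "S f \<in> L2_space M" by (rule SL[OF f])
    show "AE x in M. S (\<lambda>y. a * f y) x = a * S f x" for a
    proof -
      have "AE x in M. \<forall>k. (T ^^ k) (\<lambda>y. a * f y) x = a * (T ^^ k) f x"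
        unfolding AE_all_countable by (intro allI L2_op_scale[OF Tn f])
      then show ?thesis
        using u_summable[OF f]
        by eventually_elim (simp add: S_def u_def suminf_mult flip: times_divide_eq_right)
    qed
    fix g assume g: "g \<in> L2_space M"
    show "AE x in M. S (\<lambda>y. f y + g y) x = S f x + S g x"
    proof -
      have "AE x in M. \<forall>k. (T ^^ k) (\<lambda>y. f y + g y) x = (T ^^ k) f x + (T ^^ k) g x"
        unfolding AE_all_countable by (intro allI L2_op_add[OF Tn f g])
      then show ?thesis
        using u_summable[OF f] u_summable[OF g]
        by eventually_elim (simp add: S_def u_def suminf_add add_divide_distrib)
    qed
    show "AE x in M. S f x = S g x" if "AE x in M. f x = g x"
    proof -
      have "AE x in M. \<forall>k. (T ^^ k) f x = (T ^^ k) g x"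
        unfolding AE_all_countable by (intro allI L2_op_cong[OF Tn f g that])
      then show ?thesis by eventually_elim (simp add: S_def u_def)
    qed
  next
    have "L2_norm M (S f) \<le> (\<Sum>k. c k / cmod z) * L2_norm M f" if f: "f \<in> L2_space M" for f
    proof -
      have "L2_norm M (S f) \<le> (\<Sum>k. L2_norm M (u f k))"
        unfolding S_def[abs_def] by (rule L2_series_converges(3)[OF uL[OF f] su[OF f]])
      also have "\<dots> \<le> (\<Sum>k. c k * (L2_norm M f / cmod z))"
        by (intro suminf_le u_norm f su summable_mult2 sc)
      also have "\<dots> = (\<Sum>k. c k / cmod z) * L2_norm M f"
        using suminf_mult2[OF sc] suminf_mult2[OF summable_divide[OF sc]] by simp
      finally show ?thesis .
    qed
    then show "\<exists>C. \<forall>f\<in>L2_space M. L2_norm M (S f) \<le> C * L2_norm M f" by blast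
  qed
  have tele: "(\<lambda>k. z * u f k x - u (T f) k x) sums f x" if "summable (\<lambda>k. u f k x)" for f x
  proof -
    have "(\<lambda>k. z * u f k x) \<longlonglongrightarrow> 0"
      using tendsto_mult_left[OF summable_LIMSEQ_zero[OF that], of z] by simp
    then have "(\<lambda>k. (T ^^ k) f x / z ^ k) \<longlonglongrightarrow> 0" using z by (simp add: u_def)
    from telescope_sums'[OF this] show ?thesis
      using z by (simp add: u_def funpow_swap1)
  qed
  have "AE x in M. S (\<lambda>y. z * f y - T f y) x = f x" if f: "f \<in> L2_space M" for f
  proof -
    note Tf = L2_op_closed[OF T f] and zf = L2_space_scale[OF f]
    have "AE x in M. \<forall>k. (T ^^ k) (\<lambda>y. z * f y - T f y) x = (T ^^ k) (\<lambda>y. z * f y) x - (T ^^ k) (T f) x"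
      unfolding AE_all_countable by (intro allI L2_op_diff[OF Tn zf Tf])
    moreover have "AE x in M. \<forall>k. (T ^^ k) (\<lambda>y. z * f y) x = z * (T ^^ k) f x"
      unfolding AE_all_countable by (intro allI L2_op_scale[OF Tn f])
    ultimately show ?thesis using u_summable[OF f]
    proof eventually_elim
      case (elim x)
      have "u (\<lambda>y. z * f y - T f y) k x = z * u f k x - u (T f) k x" for k
        using elim(1,2) by (simp add: u_def diff_divide_distrib)
      then show ?case using sums_unique[OF tele[OF elim(3)]] by (simp add: S_def)
    qed
  qed
  moreover have "AE x in M. z * S f x - T (S f) x = f x" if f: "f \<in> L2_space M" for f
  proof -
    note Tf = L2_op_closed[OF T f]
    have "AE x in M. T (S f) x = (\<Sum>k. T (u f k) x)"
      unfolding S_def[abs_def] by (rule L2_op_series[OF T uL[OF f] su[OF f]])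
    moreover have "AE x in M. \<forall>k. T (u f k) x = u (T f) k x"
      unfolding AE_all_countable
    proof
      show "AE x in M. T (u f k) x = u (T f) k x" for k
        using L2_op_scale[OF T L2_op_closed[OF Tn f], of "inverse (z ^ Suc k)" k]
        by (simp add: u_def[abs_def] funpow_swap1 divide_inverse mult.commute)
    qed
    ultimately show ?thesis using u_summable[OF f] u_summable[OF Tf]
    proof eventually_elim
      case (elim x)
      have "z * S f x - T (S f) x = (\<Sum>k. z * u f k x - u (T f) k x)"
        using elim by (simp add: S_def suminf_mult[symmetric] suminf_diff summable_mult)
      then show ?case using sums_unique[OF tele[OF elim(3)]] by simp
    qed
  qed
  ultimately show ?thesis using S by (auto simp: L2_spectrum_def)
qed

section \<open>The spectral radius of a positive operator\<close>

definition L2_neumann_sum :: "'a fun_op \<Rightarrow> real \<Rightarrow> nat \<Rightarrow> 'a fun_op" where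
  "L2_neumann_sum T t K f x = (\<Sum>k<K. (T ^^ k) f x / of_real t ^ Suc k)"

lemma L2_neumann_sum_closed:
  "L2_bounded_operator M T \<Longrightarrow> f \<in> L2_space M \<Longrightarrow> L2_neumann_sum T t K f \<in> L2_space M"
  unfolding L2_neumann_sum_def[abs_def]
  by (intro L2_space_sum L2_space_divide L2_op_closed[OF L2_bounded_operator_funpow])

lemma L2_neumann_sum_telescope:
  assumes T: "L2_bounded_operator M T" and f: "f \<in> L2_space M" and t: "t \<noteq> 0"
  shows "AE x in M. of_real t * L2_neumann_sum T t K f x - T (L2_neumann_sum T t K f) x
    = f x - (T ^^ K) f x / of_real t ^ K"
proof -
  note Tn = L2_bounded_operator_funpow[OF T]
  have 1: "AE x in M. T (L2_neumann_sum T t K f) x = (\<Sum>k<K. T (\<lambda>x. (T ^^ k) f x / of_real t ^ Suc k) x)"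
    unfolding L2_neumann_sum_def[abs_def] by (intro L2_op_sum[OF T] L2_space_divide L2_op_closed[OF Tn f])
  have 2: "AE x in M. \<forall>k. T (\<lambda>x. (T ^^ k) f x / of_real t ^ Suc k) x = (T ^^ Suc k) f x / of_real t ^ Suc k"
    unfolding AE_all_countable
  proof
    show "AE x in M. T (\<lambda>x. (T ^^ k) f x / of_real t ^ Suc k) x = (T ^^ Suc k) f x / of_real t ^ Suc k" for k
      using L2_op_divide[OF T L2_op_closed[OF Tn f], of k "of_real t ^ Suc k"] by simp
  qed
  from 1 2 show ?thesis
  proof eventually_elim
    case (elim x)
    have "of_real t * L2_neumann_sum T t K f x = (\<Sum>k<K. (T ^^ k) f x / of_real t ^ k)"
      using t by (simp add: L2_neumann_sum_def sum_distrib_left)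
    then have "of_real t * L2_neumann_sum T t K f x - T (L2_neumann_sum T t K f) x
        = (\<Sum>k<K. (T ^^ k) f x / of_real t ^ k - (T ^^ Suc k) f x / of_real t ^ Suc k)"
      using elim by (simp add: sum_subtractf del: funpow.simps power_Suc)
    also have "\<dots> = f x - (T ^^ K) f x / of_real t ^ K"
      by (subst sum_lessThan_telescope') simp
    finally show ?case .
  qed
qed

text \<open>
  With \<open>p\<close> the partial sum, \<open>(L - T) p = f - T ^ K f / t ^ K - (t - L) p\<close>. The lower bound for \<open>L - T\<close>
  turns this into an estimate for \<open>p\<close> in which the last summand can be absorbed, since \<open>t\<close> is close
  to \<open>L\<close>. The resulting constant depends neither on \<open>K\<close> nor on \<open>t\<close>.
\<close>

lemma L2_neumann_sum_bound:
  assumes T: "L2_bounded_operator M T" and f: "f \<in> L2_space M"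
    and C: "0 < C" "\<And>g. g \<in> L2_space M \<Longrightarrow> L2_norm M g \<le> C * L2_norm M (\<lambda>x. of_real L * g x - T g x)"
    and t: "0 < t" "L \<le> t" "(t - L) * C \<le> 1 / 2" and K: "L2_opnorm M (T ^^ K) \<le> t ^ K"
  shows "L2_norm M (L2_neumann_sum T t K f) \<le> 4 * C * L2_norm M f"
proof -
  note TK = L2_bounded_operator_funpow[OF T, of K]
  let ?p = "L2_neumann_sum T t K f" and ?r = "\<lambda>x. (T ^^ K) f x / of_real t ^ K"
  let ?s = "\<lambda>x. of_real (t - L) * L2_neumann_sum T t K f x"
  have p: "?p \<in> L2_space M" by (rule L2_neumann_sum_closed[OF T f])
  have r: "?r \<in> L2_space M" by (intro L2_space_divide L2_op_closed[OF TK f])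
  have s: "?s \<in> L2_space M" by (rule L2_space_scale[OF p])
  have "AE x in M. of_real L * ?p x - T ?p x = (f x - ?r x) - ?s x"
    using L2_neumann_sum_telescope[OF T f, of t K] t by (auto elim!: eventually_mono simp: algebra_simps)
  then have "L2_norm M (\<lambda>x. of_real L * ?p x - T ?p x) = L2_norm M (\<lambda>x. (f x - ?r x) - ?s x)"
    by (intro L2_norm_cong L2_space_diff L2_space_scale L2_op_closed[OF T] p f r s)
  also have "\<dots> \<le> L2_norm M (\<lambda>x. f x - ?r x) + L2_norm M ?s"
    by (intro L2_norm_triangle_diff L2_space_diff f r s)
  also have "\<dots> \<le> (L2_norm M f + L2_norm M ?r) + L2_norm M ?s"
    by (intro add_right_mono L2_norm_triangle_diff f r)
  also have "L2_norm M ?r \<le> L2_norm M f"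
  proof -
    have "L2_norm M ?r = L2_norm M ((T ^^ K) f) / t ^ K"
      using t by (simp add: L2_norm_divide norm_power)
    also have "\<dots> \<le> (t ^ K * L2_norm M f) / t ^ K"
      using L2_opnorm_bound[OF TK f] mult_right_mono[OF K L2_norm_nonneg[of M f]] t
      by (intro divide_right_mono) auto
    finally show ?thesis using t by simp
  qed
  also have "L2_norm M ?s = (t - L) * L2_norm M ?p"
    using t by (subst L2_norm_scale) (simp add: norm_of_real del: of_real_diff)
  finally have "L2_norm M (\<lambda>x. of_real L * ?p x - T ?p x) \<le> 2 * L2_norm M f + (t - L) * L2_norm M ?p"
    by simp
  then have "L2_norm M ?p \<le> C * (2 * L2_norm M f + (t - L) * L2_norm M ?p)"
    using C(2)[OF p] mult_left_mono[of _ _ C] C(1) by (meson less_imp_le order_trans)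
  moreover have "(t - L) * C * L2_norm M ?p \<le> 1 / 2 * L2_norm M ?p"
    by (intro mult_right_mono t) simp
  ultimately show ?thesis by (simp add: algebra_simps)
qed

lemma L2_positive_funpow_nonneg:
  assumes T: "L2_bounded_operator M T" "L2_positive M T"
    and f: "f \<in> L2_space M" "AE x in M. f x \<in> \<real>\<^sub>\<ge>\<^sub>0"
  shows "AE x in M. \<forall>k. (T ^^ k) f x \<in> \<real>\<^sub>\<ge>\<^sub>0"
  unfolding AE_all_countable by (intro allI L2_positiveD[OF L2_positive_funpow[OF T] f])

lemma L2_neumann_sum_mono:
  assumes T: "L2_bounded_operator M T" "L2_positive M T"
    and f: "f \<in> L2_space M" "AE x in M. f x \<in> \<real>\<^sub>\<ge>\<^sub>0" and t: "0 < t" and KN: "K \<le> N"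
  shows "L2_norm M (L2_neumann_sum T t K f) \<le> L2_norm M (L2_neumann_sum T t N f)"
proof (rule L2_norm_mono[OF L2_neumann_sum_closed[OF T(1) f(1)] L2_neumann_sum_closed[OF T(1) f(1)]])
  show "AE x in M. cmod (L2_neumann_sum T t K f x) \<le> cmod (L2_neumann_sum T t N f x)"
    using L2_positive_funpow_nonneg[OF T f]
  proof eventually_elim
    case (elim x)
    let ?a = "\<lambda>k. (T ^^ k) f x / of_real t ^ Suc k"
    have a: "?a k \<in> \<real>\<^sub>\<ge>\<^sub>0" for k
      using elim t by (intro nonneg_Reals_divide_I nonneg_Reals_pow_I) auto
    have "sum ?a {..<N} - sum ?a {..<K} = sum ?a ({..<N} - {..<K})"
      by (rule sum_diff[symmetric]) (use KN in auto)
    then show ?case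
      unfolding L2_neumann_sum_def by (intro cmod_mono_nonneg_Reals nonneg_Reals_sum a) (simp only: nonneg_Reals_sum a)
  qed
qed

text \<open>
  With \<open>h\<close> the inner partial sum, keeping only the term \<open>j = m - k\<close> of \<open>h\<close> gives
  \<open>T ^ k h \<ge> T ^ m f / t ^ (j + 1)\<close> for each \<open>k \<le> m\<close>. So each of the \<open>m + 1\<close> summands of the outer sum
  contributes at least \<open>T ^ m f / t ^ (m + 2)\<close>.
\<close>

lemma L2_neumann_sum_square:
  assumes T: "L2_bounded_operator M T" "L2_positive M T"
    and f: "f \<in> L2_space M" "AE x in M. f x \<in> \<real>\<^sub>\<ge>\<^sub>0" and t: "0 < t"
  shows "real (Suc m) / t ^ (m + 2) * L2_norm M ((T ^^ m) f)
    \<le> L2_norm M (L2_neumann_sum T t (Suc m) (L2_neumann_sum T t (Suc m) f))"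
proof -
  note Tn = L2_bounded_operator_funpow[OF T(1)]
  let ?K = "Suc m"
  let ?h = "L2_neumann_sum T t ?K f"
  let ?c = "complex_of_real (real ?K / t ^ (m + 2))"
  have h: "?h \<in> L2_space M" by (rule L2_neumann_sum_closed[OF T(1) f(1)])
  have summand: "AE x in M. (T ^^ k) ?h x / of_real t ^ Suc k - (T ^^ m) f x / of_real t ^ (m + 2) \<in> \<real>\<^sub>\<ge>\<^sub>0"
    if k: "k \<le> m" for k
  proof -
    define j where "j = m - k"
    have m: "m = k + j" using k by (simp add: j_def)
    let ?g = "\<lambda>x. (T ^^ j) f x / of_real t ^ Suc j"
    have g: "?g \<in> L2_space M" by (intro L2_space_divide L2_op_closed[OF Tn] f)
    have "AE x in M. ?h x - ?g x \<in> \<real>\<^sub>\<ge>\<^sub>0"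
      using L2_positive_funpow_nonneg[OF T f]
    proof eventually_elim
      case (elim x)
      have "?h x - ?g x = (\<Sum>i\<in>{..<?K} - {j}. (T ^^ i) f x / of_real t ^ Suc i)"
        unfolding L2_neumann_sum_def by (subst sum_diff1) (use m in auto)
      also have "\<dots> \<in> \<real>\<^sub>\<ge>\<^sub>0"
        using elim t by (intro nonneg_Reals_sum nonneg_Reals_divide_I nonneg_Reals_pow_I) auto
      finally show ?case .
    qed
    then have 1: "AE x in M. (T ^^ k) ?h x - (T ^^ k) ?g x \<in> \<real>\<^sub>\<ge>\<^sub>0"
      by (rule L2_positive_mono[OF Tn L2_positive_funpow[OF T] g h])
    have 2: "AE x in M. (T ^^ k) ?g x = (T ^^ m) f x / of_real t ^ Suc j"
      using L2_op_divide[OF Tn L2_op_closed[OF Tn f(1)], of k j "of_real t ^ Suc j"] m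
      by (simp add: funpow_add)
    from 1 2 show ?thesis
    proof eventually_elim
      case (elim x)
      have "(T ^^ k) ?h x / of_real t ^ Suc k - (T ^^ m) f x / of_real t ^ (m + 2)
          = ((T ^^ k) ?h x - (T ^^ k) ?g x) / of_real t ^ Suc k"
        unfolding elim(2) using t m by (simp add: diff_divide_distrib power_add mult_ac)
      also have "\<dots> \<in> \<real>\<^sub>\<ge>\<^sub>0" using elim(1) t by (intro nonneg_Reals_divide_I nonneg_Reals_pow_I) auto
      finally show ?case .
    qed
  qed
  have "AE x in M. \<forall>k\<in>{..<?K}. (T ^^ k) ?h x / of_real t ^ Suc k - (T ^^ m) f x / of_real t ^ (m + 2) \<in> \<real>\<^sub>\<ge>\<^sub>0"
    using summand by (intro AE_ball_countable[THEN iffD2]) auto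
  then have le: "AE x in M. cmod (?c * (T ^^ m) f x) \<le> cmod (L2_neumann_sum T t ?K ?h x)"
    using L2_positive_funpow_nonneg[OF T f]
  proof eventually_elim
    case (elim x)
    have "(\<Sum>k<?K. (T ^^ k) ?h x / of_real t ^ Suc k - (T ^^ m) f x / of_real t ^ (m + 2))
       = L2_neumann_sum T t ?K ?h x - ?c * (T ^^ m) f x"
      unfolding sum_subtractf L2_neumann_sum_def[of T t ?K ?h] by simp
    moreover have "(\<Sum>k<?K. (T ^^ k) ?h x / of_real t ^ Suc k - (T ^^ m) f x / of_real t ^ (m + 2)) \<in> \<real>\<^sub>\<ge>\<^sub>0"
      by (rule nonneg_Reals_sum) (use elim in blast)
    moreover have "?c * (T ^^ m) f x \<in> \<real>\<^sub>\<ge>\<^sub>0"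
      using elim t by (intro nonneg_Reals_mult_I) (auto simp del: of_real_divide of_real_power)
    ultimately show ?case by (intro cmod_mono_nonneg_Reals) simp_all
  qed
  have "L2_norm M (\<lambda>x. ?c * (T ^^ m) f x) \<le> L2_norm M (L2_neumann_sum T t ?K ?h)"
    by (rule L2_norm_mono[OF L2_space_scale[OF L2_op_closed[OF Tn f(1)]] L2_neumann_sum_closed[OF T(1) h] le])
  moreover have "cmod ?c = real ?K / t ^ (m + 2)"
    using t by (subst norm_of_real) simp
  ultimately show ?thesis unfolding L2_norm_scale by simp
qed

text \<open>
  A Pringsheim argument: for a positive operator the limit \<open>L\<close> of the normalized norms of powers is itself a
  spectral value. If \<open>L - T\<close> had a bounded inverse, the Neumann sums would stay bounded as
  \<open>t\<close> decreases to \<open>L\<close>, and their squares would force \<open>(m + 1) * L ^ m \<le> const * L ^ (m + 2)\<close>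
  for all \<open>m = 2 ^ n\<close>.
\<close>

lemma L2_positive_spectral_value:
  assumes T: "L2_bounded_operator M T" "L2_positive M T" and L: "0 < L"
    and lower: "\<And>n. L ^ 2 ^ n \<le> L2_opnorm M (T ^^ 2 ^ n)"
    and upper: "\<And>t. L < t \<Longrightarrow> \<forall>\<^sub>F n in sequentially. L2_opnorm M (T ^^ 2 ^ n) < t ^ 2 ^ n"
  shows "complex_of_real L \<in> L2_spectrum M T"
proof (rule ccontr)
  assume "complex_of_real L \<notin> L2_spectrum M T"
  then obtain S where S: "L2_bounded_operator M S"
    and left: "\<forall>f\<in>L2_space M. AE x in M. S (\<lambda>y. of_real L * f y - T f y) x = f x"
    by (auto simp: L2_spectrum_def)
  \<comment> \<open>The summand \<open>1\<close> makes \<open>C\<close> positive even if the space is zero.\<close>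
  define C where "C = L2_opnorm M S + 1"
  have C0: "0 < C" using L2_opnorm_nonneg[OF S] by (simp add: C_def)
  have C: "L2_norm M g \<le> C * L2_norm M (\<lambda>x. of_real L * g x - T g x)" if g: "g \<in> L2_space M" for g
  proof -
    let ?w = "\<lambda>x. of_real L * g x - T g x"
    have w: "?w \<in> L2_space M" by (intro L2_space_diff L2_space_scale L2_op_closed[OF T(1)] g)
    have "L2_norm M g = L2_norm M (S ?w)"
      by (rule L2_norm_cong[OF L2_op_closed[OF S w] g, symmetric]) (use left g in blast)
    also have "\<dots> \<le> L2_opnorm M S * L2_norm M ?w" by (rule L2_opnorm_bound[OF S w])
    also have "\<dots> \<le> C * L2_norm M ?w" by (simp add: C_def mult_right_mono)
    finally show ?thesis .
  qed
  have sums: "L2_norm M (L2_neumann_sum T t K f) \<le> 4 * C * L2_norm M f"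
    if f: "f \<in> L2_space M" "AE x in M. f x \<in> \<real>\<^sub>\<ge>\<^sub>0" and t: "L < t" "(t - L) * C \<le> 1 / 2" for f t K
  proof -
    \<comment> \<open>The bound is available at lengths \<open>2 ^ n\<close> with \<open>n\<close> large; monotonicity in the length does the rest.\<close>
    have "\<forall>\<^sub>F n in sequentially. L2_opnorm M (T ^^ 2 ^ n) < t ^ 2 ^ n \<and> K \<le> n"
      by (intro eventually_conj upper t eventually_ge_at_top)
    then obtain n where n: "L2_opnorm M (T ^^ 2 ^ n) < t ^ 2 ^ n" "K \<le> n"
      by (auto simp: eventually_sequentially)
    have "K \<le> 2 ^ n" using n(2) less_exp[of n] by linarith
    then have "L2_norm M (L2_neumann_sum T t K f) \<le> L2_norm M (L2_neumann_sum T t (2 ^ n) f)"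
      using t L by (intro L2_neumann_sum_mono[OF T f]) auto
    also have "\<dots> \<le> 4 * C * L2_norm M f"
      by (rule L2_neumann_sum_bound[OF T(1) f(1) C0 C]) (use t L n in auto)
    finally show ?thesis .
  qed
  have power: "L2_opnorm M (T ^^ m) \<le> 16 * C\<^sup>2 * t ^ (m + 2) / real (Suc m)"
    if t: "L < t" "(t - L) * C \<le> 1 / 2" for t m
  proof (rule L2_opnorm_least_positive[OF L2_bounded_operator_funpow[OF T(1)] L2_positive_funpow[OF T]])
    have t0: "0 < t" using t L by simp
    then show "0 \<le> 16 * C\<^sup>2 * t ^ (m + 2) / real (Suc m)" by simp
    fix f assume f: "f \<in> L2_space M" "AE x in M. f x \<in> \<real>\<^sub>\<ge>\<^sub>0"
    let ?h = "L2_neumann_sum T t (Suc m) f"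
    have h: "?h \<in> L2_space M" by (rule L2_neumann_sum_closed[OF T(1) f(1)])
    have h0: "AE x in M. ?h x \<in> \<real>\<^sub>\<ge>\<^sub>0"
      using L2_positive_funpow_nonneg[OF T f]
      unfolding L2_neumann_sum_def
      by eventually_elim (use t0 in \<open>intro nonneg_Reals_sum nonneg_Reals_divide_I nonneg_Reals_pow_I, auto\<close>)
    have "real (Suc m) / t ^ (m + 2) * L2_norm M ((T ^^ m) f)
        \<le> L2_norm M (L2_neumann_sum T t (Suc m) ?h)" by (rule L2_neumann_sum_square[OF T f t0])
    also have "\<dots> \<le> 4 * C * L2_norm M ?h" by (rule sums[OF h h0 t])
    also have "\<dots> \<le> 4 * C * (4 * C * L2_norm M f)"
      using C0 by (intro mult_left_mono sums[OF f t]) simp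
    finally show "L2_norm M ((T ^^ m) f) \<le> 16 * C\<^sup>2 * t ^ (m + 2) / real (Suc m) * L2_norm M f"
      using t0 by (simp add: field_simps power2_eq_square)
  qed
  have "real (Suc (2 ^ n)) \<le> 16 * C\<^sup>2 * L\<^sup>2" for n
  proof -
    let ?m = "2 ^ n :: nat"
    \<comment> \<open>A sequence decreasing to \<open>L\<close> on which \<open>(t - L) * C \<le> 1 / 2\<close>.\<close>
    let ?t = "\<lambda>i. L + inverse (real (Suc i)) * (1 / (2 * C))"
    have t: "?t \<longlonglongrightarrow> L + 0 * (1 / (2 * C))"
      by (intro tendsto_intros LIMSEQ_inverse_real_of_nat)
    have "(\<lambda>i. 16 * C\<^sup>2 * ?t i ^ (?m + 2) / real (Suc ?m))
        \<longlonglongrightarrow> 16 * C\<^sup>2 * (L + 0 * (1 / (2 * C))) ^ (?m + 2) / real (Suc ?m)"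
      by (rule tendsto_divide[OF tendsto_mult[OF tendsto_const tendsto_power[OF t]] tendsto_const])
        (simp del: of_nat_Suc)
    moreover have "L ^ ?m \<le> 16 * C\<^sup>2 * ?t i ^ (?m + 2) / real (Suc ?m)" for i
    proof (rule order_trans[OF lower power])
      show "L < ?t i" using C0 by simp
      have "(?t i - L) * C = inverse (real (Suc i)) * (1 / 2)" using C0 by simp
      also have "\<dots> \<le> 1 / 2" by (simp add: inverse_le_1_iff)
      finally show "(?t i - L) * C \<le> 1 / 2" .
    qed
    ultimately have "L ^ ?m \<le> 16 * C\<^sup>2 * L ^ (?m + 2) / real (Suc ?m)"
      by (intro LIMSEQ_le_const[where X = "\<lambda>i. 16 * C\<^sup>2 * ?t i ^ (?m + 2) / real (Suc ?m)"]) auto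
    then have "L ^ ?m * real (Suc ?m) \<le> L ^ ?m * (16 * C\<^sup>2 * L\<^sup>2)"
      by (simp add: field_simps power_add power2_eq_square del: of_nat_Suc)
    then show ?thesis using L by simp
  qed
  moreover obtain n :: nat where "16 * C\<^sup>2 * L\<^sup>2 < real n" using reals_Archimedean2 by blast
  moreover have "real n < real (2 ^ n)" for n by (simp only: of_nat_less_iff less_exp)
  ultimately show False by (metis less_le_not_le less_trans of_nat_less_iff lessI)
qed

lemma power_root_2: "0 \<le> b \<Longrightarrow> (b powr (1 / 2 ^ n)) ^ 2 ^ n = (b :: real)"
  by (subst powr_realpow'[symmetric]) (auto simp: powr_powr)

text \<open>
  Submultiplicativity under squaring makes the sequence of \<open>2 ^ n\<close>-th roots decrease. It serves both
  for the norms of powers and for the norms of their symmetrizations.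
\<close>

lemma root_2_step:
  fixes a b :: real
  assumes "0 \<le> a" "0 \<le> b" "b \<le> a\<^sup>2"
  shows "b powr (1 / 2 ^ Suc n) \<le> a powr (1 / 2 ^ n)"
proof -
  have "b powr (1 / 2 ^ Suc n) \<le> (a powr 2) powr (1 / 2 ^ Suc n)"
    using assms by (intro powr_mono2) auto
  also have "\<dots> = a powr (1 / 2 ^ n)" by (simp only: powr_powr) simp
  finally show ?thesis .
qed

lemma funpow_2_Suc: "T ^^ 2 ^ Suc n = (T ^^ 2 ^ n) \<circ> (T ^^ 2 ^ n)"
  by (simp add: mult_2 funpow_add)

text \<open>
  The normalized norms decrease, so \<open>L\<close> bounds them from below. A point outside the closed disc
  of radius \<open>L\<close> has a Neumann series, and for \<open>L > 0\<close> the value \<open>L\<close> itself lies in the spectrum; for \<open>L = 0\<close>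
  the maximum is the inserted \<open>0\<close>.
\<close>

theorem L2_spectral_radius_positive:
  assumes T: "L2_bounded_operator M T" "L2_positive M T"
    and lim: "(\<lambda>n. L2_opnorm M (T ^^ 2 ^ n) powr (1 / 2 ^ n)) \<longlonglongrightarrow> L"
  shows "L2_spectral_radius M T = L"
proof -
  let ?b = "\<lambda>n. L2_opnorm M (T ^^ 2 ^ n)"
  let ?a = "\<lambda>n. ?b n powr (1 / 2 ^ n)"
  note Tn = L2_bounded_operator_funpow[OF T(1)]
  have b0: "0 \<le> ?b n" for n by (rule L2_opnorm_nonneg[OF Tn])
  have "?b (Suc n) \<le> (?b n)\<^sup>2" for n
    unfolding funpow_2_Suc power2_eq_square by (rule L2_opnorm_comp[OF Tn Tn])
  then have "?a (Suc n) \<le> ?a n" for n by (intro root_2_step b0)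
  then have "decseq ?a" by (simp add: decseq_Suc_iff)
  then have La: "L \<le> ?a n" for n using lim by (rule decseq_ge)
  have L0: "0 \<le> L" by (rule LIMSEQ_le_const[OF lim]) auto
  have lower: "L ^ 2 ^ n \<le> ?b n" for n
    using power_mono[OF La[of n] L0, of "2 ^ n"] by (simp add: power_root_2 b0)
  have upper: "\<forall>\<^sub>F n in sequentially. ?b n < t ^ 2 ^ n" if "L < t" for t
    using order_tendstoD(2)[OF lim that]
  proof eventually_elim
    case (elim n)
    then have "?a n ^ 2 ^ n < t ^ 2 ^ n" by (intro power_strict_mono) auto
    then show ?case by (simp add: power_root_2 b0)
  qed
  have out: "cmod z \<le> L" if z: "z \<in> L2_spectrum M T" for z
  proof (rule ccontr)
    assume "\<not> cmod z \<le> L"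
    then have "\<forall>\<^sub>F n in sequentially. ?b n < cmod z ^ 2 ^ n" by (intro upper) simp
    then obtain n where "?b n < cmod z ^ 2 ^ n" by (auto simp: eventually_sequentially)
    then show False using L2_not_in_spectrum[OF T(1), of "2 ^ n" z] z by simp
  qed
  have "L \<in> insert 0 (cmod ` L2_spectrum M T)"
  proof (cases "L = 0")
    case False
    then have "complex_of_real L \<in> L2_spectrum M T"
      using L0 by (intro L2_positive_spectral_value[OF T _ lower upper]) auto
    then show ?thesis using L0 by (auto intro!: image_eqI[of _ _ "complex_of_real L"])
  qed simp
  then show ?thesis
    unfolding L2_spectral_radius_def by (rule cSup_eq_maximum) (use out L0 in auto)
qed

section \<open>Positive symmetric operators\<close>

definition L2_symmetric :: "'a measure \<Rightarrow> 'a fun_op \<Rightarrow> bool" where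
  "L2_symmetric M S \<longleftrightarrow> (\<forall>f\<in>L2_space M. \<forall>g\<in>L2_space M. L2_inner M (S f) g = L2_inner M f (S g))"

lemma L2_symmetricD:
  "L2_symmetric M S \<Longrightarrow> f \<in> L2_space M \<Longrightarrow> g \<in> L2_space M \<Longrightarrow> L2_inner M (S f) g = L2_inner M f (S g)"
  by (simp add: L2_symmetric_def)

lemma L2_symmetric_funpow:
  assumes S: "L2_bounded_operator M S" "L2_symmetric M S"
  shows "L2_symmetric M (S ^^ n)"
proof (induction n)
  case 0
  then show ?case by (simp add: L2_symmetric_def)
next
  case (Suc n)
  note Sn = L2_op_closed[OF L2_bounded_operator_funpow[OF S(1)]]
  have "L2_inner M ((S ^^ Suc n) f) g = L2_inner M f ((S ^^ Suc n) g)"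
    if f: "f \<in> L2_space M" and g: "g \<in> L2_space M" for f g
  proof -
    have "L2_inner M ((S ^^ Suc n) f) g = L2_inner M ((S ^^ n) f) (S g)"
      using L2_symmetricD[OF S(2) Sn[OF f] g] by simp
    also have "\<dots> = L2_inner M f ((S ^^ n) (S g))"
      by (rule L2_symmetricD[OF Suc f L2_op_closed[OF S(1) g]])
    finally show ?thesis by (simp add: funpow_swap1)
  qed
  then show ?case by (simp add: L2_symmetric_def)
qed

text \<open>
  \<open>\<parallel>S f\<parallel>\<^sup>2 = \<langle>S (S f), f\<rangle> \<le> \<parallel>S\<^sup>2\<parallel> \<parallel>f\<parallel>\<^sup>2\<close>.
\<close>

lemma L2_opnorm_symmetric_square:
  assumes S: "L2_bounded_operator M S" "L2_symmetric M S"
  shows "L2_opnorm M (S \<circ> S) = (L2_opnorm M S)\<^sup>2"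
proof (rule antisym)
  show "L2_opnorm M (S \<circ> S) \<le> (L2_opnorm M S)\<^sup>2"
    unfolding power2_eq_square by (rule L2_opnorm_comp[OF S(1) S(1)])
  let ?q = "L2_opnorm M (S \<circ> S)"
  have SS: "L2_bounded_operator M (S \<circ> S)" by (rule L2_bounded_operator_comp[OF S(1) S(1)])
  have q: "0 \<le> ?q" by (rule L2_opnorm_nonneg[OF SS])
  have "L2_opnorm M S \<le> sqrt ?q"
  proof (rule L2_opnorm_least)
    fix f assume f: "f \<in> L2_space M"
    note Sf = L2_op_closed[OF S(1) f]
    have "(L2_norm M (S f))\<^sup>2 = cmod (L2_inner M (S f) (S f))"
      by (simp add: L2_inner_self norm_power)
    also have "\<dots> = cmod (L2_inner M ((S \<circ> S) f) f)"
      using L2_symmetricD[OF S(2) Sf f] by simp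
    also have "\<dots> \<le> L2_norm M ((S \<circ> S) f) * L2_norm M f"
      by (rule L2_Cauchy_Schwarz[OF L2_op_closed[OF SS f] f])
    also have "\<dots> \<le> (?q * L2_norm M f) * L2_norm M f"
      by (intro mult_right_mono L2_opnorm_bound[OF SS f]) simp
    also have "\<dots> = (sqrt ?q * L2_norm M f)\<^sup>2" using q by (simp add: power2_eq_square)
    finally show "L2_norm M (S f) \<le> sqrt ?q * L2_norm M f"
      by (rule power2_le_imp_le) (simp add: q)
  qed (simp add: q)
  then have "(L2_opnorm M S)\<^sup>2 \<le> (sqrt ?q)\<^sup>2"
    by (intro power_mono L2_opnorm_nonneg S) 
  then show "(L2_opnorm M S)\<^sup>2 \<le> ?q" using q by simp
qed

lemma L2_spectral_radius_symmetric:
  assumes S: "L2_bounded_operator M S" "L2_positive M S" "L2_symmetric M S"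
  shows "L2_spectral_radius M S = L2_opnorm M S"
proof (rule L2_spectral_radius_positive[OF S(1,2)])
  have "L2_opnorm M (S ^^ 2 ^ n) = L2_opnorm M S ^ 2 ^ n" for n
  proof (induction n)
    case (Suc n)
    have "L2_opnorm M (S ^^ 2 ^ Suc n) = (L2_opnorm M (S ^^ 2 ^ n))\<^sup>2"
      unfolding funpow_2_Suc
      by (intro L2_opnorm_symmetric_square L2_bounded_operator_funpow L2_symmetric_funpow S)
    then show ?case by (simp add: Suc power_mult[symmetric] mult.commute)
  qed simp
  moreover have "(L2_opnorm M S ^ 2 ^ n) powr (1 / 2 ^ n) = L2_opnorm M S" for n
    using L2_opnorm_nonneg[OF S(1)]
    by (subst powr_realpow'[symmetric]) (auto simp: powr_powr)
  ultimately show "(\<lambda>n. L2_opnorm M (S ^^ 2 ^ n) powr (1 / 2 ^ n)) \<longlonglongrightarrow> L2_opnorm M S"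
    by simp
qed

text \<open>
  Only an upper bound of the form is assumed: positivity supplies the lower one, because
  \<open>|\<langle>S g, g\<rangle>| \<le> \<langle>S |g|, |g|\<rangle>\<close>. Polarization then bounds \<open>Re \<langle>S f, g\<rangle>\<close>, and \<open>g\<close> is taken parallel to
  \<open>S f\<close> with the length of \<open>f\<close>.
\<close>

lemma L2_opnorm_le_quadratic_form:
  assumes S: "L2_bounded_operator M S" "L2_positive M S" "L2_symmetric M S" and c: "0 \<le> c"
    and q: "\<And>f. f \<in> L2_space M \<Longrightarrow> Re (L2_inner M (S f) f) \<le> c * (L2_norm M f)\<^sup>2"
  shows "L2_opnorm M S \<le> c"
proof (rule L2_opnorm_least[OF c])
  fix f assume f: "f \<in> L2_space M"
  note Sf = L2_op_closed[OF S(1) f]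
  have abs_q: "\<bar>Re (L2_inner M (S g) g)\<bar> \<le> c * (L2_norm M g)\<^sup>2" if g: "g \<in> L2_space M" for g
  proof -
    have "\<bar>Re (L2_inner M (S g) g)\<bar> \<le> cmod (L2_inner M (S g) g)" by (rule abs_Re_le_cmod)
    also note L2_positive_quadratic_modulus[OF S(1,2) g]
    also have "Re (L2_inner M (S (\<lambda>x. of_real (cmod (g x)))) (\<lambda>x. of_real (cmod (g x))))
        \<le> c * (L2_norm M g)\<^sup>2"
      using q[OF L2_space_cmod[OF g]] by simp
    finally show ?thesis .
  qed
  have polar: "2 * Re (L2_inner M (S f) g) \<le> c * ((L2_norm M f)\<^sup>2 + (L2_norm M g)\<^sup>2)"
    if g: "g \<in> L2_space M" for g
  proof -
    note Sg = L2_op_closed[OF S(1) g]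
    let ?p = "\<lambda>x. f x + g x" and ?m = "\<lambda>x. f x - g x"
    have p: "?p \<in> L2_space M" and m: "?m \<in> L2_space M" by (intro L2_space_intros f g)+
    have cross: "Re (L2_inner M (S g) f) = Re (L2_inner M (S f) g)"
      using L2_symmetricD[OF S(3) g f] L2_inner_commute[of M g "S f"] by simp
    have "L2_inner M (S ?p) ?p = L2_inner M (\<lambda>x. S f x + S g x) ?p"
      by (intro L2_inner_congL L2_op_closed[OF S(1)] L2_space_add L2_op_add[OF S(1)] f g p)
    then have 1: "Re (L2_inner M (S ?p) ?p)
        = Re (L2_inner M (S f) f) + 2 * Re (L2_inner M (S f) g) + Re (L2_inner M (S g) g)"
      by (simp add: L2_inner_add_left L2_inner_add_right f g Sf Sg p cross)
    have "L2_inner M (S ?m) ?m = L2_inner M (\<lambda>x. S f x + (- 1) * S g x) (\<lambda>x. f x + (- 1) * g x)"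
      using L2_inner_congL[OF L2_op_closed[OF S(1) m] L2_space_diff[OF Sf Sg] L2_op_diff[OF S(1) f g] m]
      by simp
    then have 2: "Re (L2_inner M (S ?m) ?m)
        = Re (L2_inner M (S f) f) - 2 * Re (L2_inner M (S f) g) + Re (L2_inner M (S g) g)"
      by (simp only: L2_inner_add_left L2_inner_add_right L2_inner_scale_left L2_inner_scale_right
          f g Sf Sg L2_space_add L2_space_scale) (simp add: cross)
    have "4 * Re (L2_inner M (S f) g) \<le> c * (L2_norm M ?p)\<^sup>2 + c * (L2_norm M ?m)\<^sup>2"
      using 1 2 abs_q[OF p] abs_q[OF m] by linarith
    then show ?thesis by (simp add: L2_norm_add_square'[OF f g] algebra_simps)
  qed
  let ?a = "L2_norm M f" and ?b = "L2_norm M (S f)"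
  show "?b \<le> c * ?a"
  proof (cases "?a = 0 \<or> ?b = 0")
    case True
    then show ?thesis using L2_opnorm_bound[OF S(1) f] c by auto
  next
    case False
    then have ab: "0 < ?a" "0 < ?b" using L2_norm_nonneg[of M f] L2_norm_nonneg[of M "S f"] by linarith+
    let ?g = "\<lambda>x. of_real (?a / ?b) * S f x"
    have "Re (L2_inner M (S f) ?g) = ?a * ?b"
      using ab by (subst L2_inner_scale_right) (simp add: L2_inner_self power2_eq_square)
    moreover have "L2_norm M ?g = ?a" using ab by (subst L2_norm_scale) (simp add: norm_divide)
    ultimately have "2 * (?a * ?b) \<le> c * (?a\<^sup>2 + ?a\<^sup>2)"
      using polar[OF L2_space_scale[OF Sf, of "of_real (?a / ?b)"]] by simp
    then have "?a * ?b \<le> ?a * (c * ?a)" by (simp add: power2_eq_square algebra_simps)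
    then show ?thesis using ab by simp
  qed
qed

section \<open>The arithmetic symmetrization\<close>

lemma arith_symm_bounded_operator:
  assumes T: "L2_bounded_operator M T"
  shows "L2_bounded_operator M (arith_symm M T)"
proof -
  note T' = L2_adjoint_bounded_operator[OF T]
  show ?thesis
    unfolding L2_bounded_operator_def
  proof (intro conjI ballI allI impI)
    fix f assume f: "f \<in> L2_space M"
    note Tf = L2_op_closed[OF T f] L2_op_closed[OF T' f]
    show "arith_symm M T f \<in> L2_space M"
      unfolding arith_symm_def by (intro L2_space_intros Tf)
    show "AE x in M. arith_symm M T (\<lambda>y. c * f y) x = c * arith_symm M T f x" for c
      using L2_op_scale[OF T f, of c] L2_op_scale[OF T' f, of c]
      by eventually_elim (simp add: arith_symm_def algebra_simps)
    fix g assume g: "g \<in> L2_space M"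
    show "AE x in M. arith_symm M T (\<lambda>y. f y + g y) x = arith_symm M T f x + arith_symm M T g x"
      using L2_op_add[OF T f g] L2_op_add[OF T' f g]
      by eventually_elim (simp add: arith_symm_def add_divide_distrib)
    show "AE x in M. arith_symm M T f x = arith_symm M T g x" if fg: "AE x in M. f x = g x"
      using L2_op_cong[OF T f g fg] L2_op_cong[OF T' f g fg]
      by eventually_elim (simp add: arith_symm_def)
  next
    have "L2_norm M (arith_symm M T f) \<le> (L2_opnorm M T + L2_opnorm M (L2_adjoint M T)) / 2 * L2_norm M f"
      if f: "f \<in> L2_space M" for f
      using L2_norm_triangle[OF L2_op_closed[OF T f] L2_op_closed[OF T' f]]
        L2_opnorm_bound[OF T f] L2_opnorm_bound[OF T' f]
      by (simp add: arith_symm_def L2_norm_divide algebra_simps)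
    then show "\<exists>C. \<forall>f\<in>L2_space M. L2_norm M (arith_symm M T f) \<le> C * L2_norm M f" by blast
  qed
qed

lemma arith_symm_opnorm_le:
  assumes T: "L2_bounded_operator M T"
  shows "L2_opnorm M (arith_symm M T) \<le> L2_opnorm M T"
proof (rule L2_opnorm_least[OF L2_opnorm_nonneg[OF T]])
  fix f assume f: "f \<in> L2_space M"
  show "L2_norm M (arith_symm M T f) \<le> L2_opnorm M T * L2_norm M f"
    using L2_norm_triangle[OF L2_op_closed[OF T f] L2_adjoint_closed[OF T f]]
      L2_opnorm_bound[OF T f] L2_adjoint_bound[OF T f]
    by (simp add: arith_symm_def L2_norm_divide)
qed

lemma arith_symm_positive:
  assumes T: "L2_bounded_operator M T" "L2_positive M T"
  shows "L2_positive M (arith_symm M T)"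
  unfolding L2_positive_def
proof (intro ballI impI)
  fix f assume f: "f \<in> L2_space M" "AE x in M. f x \<in> \<real>\<^sub>\<ge>\<^sub>0"
  show "AE x in M. arith_symm M T f x \<in> \<real>\<^sub>\<ge>\<^sub>0"
    using L2_positiveD[OF T(2) f] L2_positiveD[OF L2_adjoint_positive[OF T] f]
    by eventually_elim (auto simp: arith_symm_def)
qed

text \<open>
  The form of the symmetrization in terms of \<open>T\<close> alone. In particular its quadratic form is
  \<open>Re \<langle>T f, f\<rangle>\<close>.
\<close>

lemma arith_symm_inner:
  assumes T: "L2_bounded_operator M T" and f: "f \<in> L2_space M" and g: "g \<in> L2_space M"
  shows "L2_inner M (arith_symm M T f) g = (L2_inner M (T f) g + cnj (L2_inner M (T g) f)) / 2"
proof -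
  note c = L2_op_closed[OF T f] L2_adjoint_closed[OF T f]
  have "arith_symm M T f = (\<lambda>x. (1 / 2) * (T f x + L2_adjoint M T f x))"
    by (simp add: arith_symm_def)
  then have "L2_inner M (arith_symm M T f) g
      = (1 / 2) * (L2_inner M (T f) g + L2_inner M (L2_adjoint M T f) g)"
    by (simp only: L2_inner_scale_left L2_inner_add_left[OF c g])
  also have "L2_inner M (L2_adjoint M T f) g = cnj (L2_inner M (T g) f)"
    by (subst L2_inner_commute) (simp add: L2_adjoint_inner[OF T f g])
  finally show ?thesis by simp
qed

lemma arith_symm_symmetric:
  assumes T: "L2_bounded_operator M T"
  shows "L2_symmetric M (arith_symm M T)"
  unfolding L2_symmetric_def
proof (intro ballI)
  fix f g assume f: "f \<in> L2_space M" and g: "g \<in> L2_space M"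
  show "L2_inner M (arith_symm M T f) g = L2_inner M f (arith_symm M T g)"
    by (subst L2_inner_commute[of M f "arith_symm M T g"])
      (simp add: arith_symm_inner[OF T] f g add.commute)
qed

lemma L2_spectral_radius_arith_symm:
  assumes T: "L2_bounded_operator M T" "L2_positive M T"
  shows "L2_spectral_radius M (arith_symm M T) = L2_opnorm M (arith_symm M T)"
  using T by (intro L2_spectral_radius_symmetric arith_symm_bounded_operator arith_symm_positive
      arith_symm_symmetric)

text \<open>
  On nonnegative \<open>f\<close>, \<open>0 \<le> T f \<le> T f + T\<^sup>* f = 2 M(T) f\<close>.
\<close>

lemma opnorm_le_arith_symm:
  assumes T: "L2_bounded_operator M T" "L2_positive M T"
  shows "L2_opnorm M T \<le> 2 * L2_opnorm M (arith_symm M T)"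
proof (rule L2_opnorm_least_positive[OF T])
  note S = arith_symm_bounded_operator[OF T(1)]
  show "0 \<le> 2 * L2_opnorm M (arith_symm M T)" using L2_opnorm_nonneg[OF S] by simp
  fix f assume f: "f \<in> L2_space M" "AE x in M. f x \<in> \<real>\<^sub>\<ge>\<^sub>0"
  have "L2_norm M (T f) \<le> L2_norm M (\<lambda>x. 2 * arith_symm M T f x)"
  proof (rule L2_norm_mono[OF L2_op_closed[OF T(1) f(1)] L2_space_scale[OF L2_op_closed[OF S f(1)]]])
    show "AE x in M. cmod (T f x) \<le> cmod (2 * arith_symm M T f x)"
      using L2_positiveD[OF T(2) f] L2_positiveD[OF L2_adjoint_positive[OF T] f]
      by eventually_elim (rule cmod_mono_nonneg_Reals, auto simp: arith_symm_def field_simps)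
  qed
  also have "\<dots> \<le> 2 * L2_opnorm M (arith_symm M T) * L2_norm M f"
    using L2_opnorm_bound[OF S f(1)] by (simp add: L2_norm_scale)
  finally show "L2_norm M (T f) \<le> 2 * L2_opnorm M (arith_symm M T) * L2_norm M f" .
qed

text \<open>
  A power inequality for the numerical radius of a positive operator. It rests on
  \<open>Re \<langle>u, v\<rangle> \<le> \<parallel>(u + v) / 2\<parallel>\<^sup>2\<close> with \<open>u = T f\<close> and \<open>v = T\<^sup>* f\<close>.
\<close>

lemma arith_symm_opnorm_square:
  assumes T: "L2_bounded_operator M T" "L2_positive M T"
  shows "L2_opnorm M (arith_symm M (T \<circ> T)) \<le> (L2_opnorm M (arith_symm M T))\<^sup>2"
proof (rule L2_opnorm_le_quadratic_form)
  note TT = L2_bounded_operator_comp[OF T(1) T(1)] L2_positive_comp[OF T(2) T]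
  note S = arith_symm_bounded_operator[OF T(1)]
  show "L2_bounded_operator M (arith_symm M (T \<circ> T))" "L2_positive M (arith_symm M (T \<circ> T))"
    "L2_symmetric M (arith_symm M (T \<circ> T))"
    by (intro arith_symm_bounded_operator arith_symm_positive arith_symm_symmetric TT)+
  fix f assume f: "f \<in> L2_space M"
  let ?u = "T f" and ?v = "L2_adjoint M T f"
  have u: "?u \<in> L2_space M" and v: "?v \<in> L2_space M"
    using L2_op_closed[OF T(1) f] L2_adjoint_closed[OF T(1) f] by auto
  have "Re (L2_inner M (arith_symm M (T \<circ> T) f) f) = Re (L2_inner M (T ?u) f)"
    by (simp add: arith_symm_inner[OF TT(1) f f])
  also have "\<dots> = Re (L2_inner M ?u ?v)" by (simp add: L2_adjoint_inner[OF T(1) f u])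
  also have "\<dots> \<le> (L2_norm M (\<lambda>x. ?u x + ?v x))\<^sup>2 / 4"
    using L2_norm_add_square'[OF u v] zero_le_power2[of "L2_norm M (\<lambda>x. ?u x - ?v x)"] by simp
  also have "\<dots> = (L2_norm M (arith_symm M T f))\<^sup>2"
    by (simp add: arith_symm_def L2_norm_divide power_divide)
  also have "\<dots> \<le> (L2_opnorm M (arith_symm M T) * L2_norm M f)\<^sup>2"
    by (intro power_mono L2_opnorm_bound[OF S f]) simp
  finally show "Re (L2_inner M (arith_symm M (T \<circ> T) f) f)
      \<le> (L2_opnorm M (arith_symm M T))\<^sup>2 * (L2_norm M f)\<^sup>2"
    by (simp add: power_mult_distrib)
qed simp

theorem theorem2p3:
  fixes M :: "'a measure" and A :: "('a \<Rightarrow> complex) \<Rightarrow> ('a \<Rightarrow> complex)"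
  assumes "sigma_finite_measure M"
    and "L2_bounded_operator M A"
    and "L2_positive M A"
  shows "(\<forall>n. (\<forall>i<n. symm_radius_seq M A i \<ge> symm_radius_seq M A (Suc i)) \<and>
              symm_radius_seq M A n \<ge> L2_spectral_radius M A) \<and>
         symm_radius_seq M A \<longlonglongrightarrow> L2_spectral_radius M A"
proof -
  let ?\<sigma> = "symm_radius_seq M A"
  let ?P = "\<lambda>n. A ^^ 2 ^ n"
  let ?s = "\<lambda>n. L2_opnorm M (arith_symm M (?P n))"
  let ?a = "\<lambda>n. L2_opnorm M (?P n) powr (1 / 2 ^ n)"
  have P: "L2_bounded_operator M (?P n)" "L2_positive M (?P n)" for n
    using assms(2,3) by (auto intro: L2_bounded_operator_funpow L2_positive_funpow)
  have s0: "0 \<le> ?s n" for n by (intro L2_opnorm_nonneg arith_symm_bounded_operator P)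
  have \<sigma>: "?\<sigma> n = ?s n powr (1 / 2 ^ n)" for n
    unfolding symm_radius_seq_def L2_spectral_radius_arith_symm[OF P] ..
  have step: "?\<sigma> (Suc n) \<le> ?\<sigma> n" for n
    unfolding \<sigma> funpow_2_Suc
    using arith_symm_opnorm_square[OF P[of n]]
    by (intro root_2_step s0 L2_opnorm_nonneg arith_symm_bounded_operator L2_bounded_operator_comp P)
  then have dec: "decseq ?\<sigma>" by (simp add: decseq_Suc_iff)
  have "\<forall>n. 0 \<le> ?\<sigma> n" by (simp add: \<sigma>)
  then obtain L where L: "?\<sigma> \<longlonglongrightarrow> L" using decseq_convergent[OF dec] by blast
  have "?a \<longlonglongrightarrow> L"
  proof (rule tendsto_sandwich[OF always_eventually always_eventually L])
    show "\<forall>n. ?\<sigma> n \<le> ?a n"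
      unfolding \<sigma> by (intro allI powr_mono2 arith_symm_opnorm_le P s0) simp
    show "\<forall>n. ?a n \<le> 2 powr (1 / 2 ^ n) * ?\<sigma> n"
    proof
      fix n
      have "?a n \<le> (2 * ?s n) powr (1 / 2 ^ n)"
        by (intro powr_mono2 opnorm_le_arith_symm P L2_opnorm_nonneg) simp
      then show "?a n \<le> 2 powr (1 / 2 ^ n) * ?\<sigma> n" by (simp add: \<sigma> powr_mult s0)
    qed
    have "(\<lambda>n. (1 / 2 :: real) ^ n) \<longlonglongrightarrow> 0" by (intro LIMSEQ_realpow_zero) auto
    then have "(\<lambda>n. 1 / 2 ^ n :: real) \<longlonglongrightarrow> 0" by (simp add: power_one_over)
    then have "(\<lambda>n. 2 powr (1 / 2 ^ n) * ?\<sigma> n) \<longlonglongrightarrow> 2 powr 0 * L"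
      by (intro tendsto_intros L) auto
    then show "(\<lambda>n. 2 powr (1 / 2 ^ n) * ?\<sigma> n) \<longlonglongrightarrow> L" by simp
  qed
  then have "L2_spectral_radius M A = L"
    by (rule L2_spectral_radius_positive[OF assms(2,3)])
  then show ?thesis using step L decseq_ge[OF dec L] by auto
qed

end
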